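(* Let $(\overline M,\overline J,\overline g,\overline{\widetilde g})$ be a $2n$-dimensional almost complex manifold with Norden metric, let $M$ be an $m$-dimensional submanifold of $\overline M$ with induced tensor fields $g=\overline g|_{TM}$ and $\widetilde g=\overline{\widetilde g}|_{TM}$, and let $r\ge 1$. Then $(M,g)$ is a CR-submanifold of $(\overline M,\overline J,\overline g)$ with an $r$-dimensional totally real distribution $D^\bot$ if and only if $(M,\widetilde g)$ is an $r$-lightlike Radical transversal lightlike submanifold of $\overline M$ (lightlike with respect to $\overline{\widetilde g}$).
   Context: An almost complex manifold with Norden metric is a smooth $2n$-dimensional manifold $\overline M$ with an almost complex structure $\overline J$ ($\overline J^2=-\mathrm{Id}$) and a semi-Riemannian metric $\overline g$ such that $\overline g(\overline JX,\overline JY)=-\overline g(X,Y)$ for all vector fields $X,Y$. The associated metric is $\overline{\widetilde g}(X,Y)=\overline g(\overline JX,Y)$; it is also a Norden metric, and both metrics have signature $(n,n)$. CR-submanifold: $(M,g)$ is a CR-submanifold if $g$ is non-degenerate on $TM$ and $M$ carries two smooth complementary distributions $D$, $D^\bot$ ($TM=D\oplus D^\bot$), orthogonal with respect to $g$, such that for all $x\in M$: $\overline J(D_x)=D_x$ and $\overline J(D^\bot_x)\subset T_xM^\bot$, where $TM^\bot$ is the normal bundle of $M$ with respect to $\overline g$. $D^\bot$ is called the totally real distribution. Lightlike submanifolds with respect to $\overline{\widetilde g}$: let $TM^{\widetilde\bot}$ be the orthogonal bundle of $TM$ in $T\overline M|_M$ with respect to $\overline{\widetilde g}$, and $\mathrm{Rad}\,T_xM=T_xM\cap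 T_xM^{\widetilde\bot}$. $(M,\widetilde g)$ is $r$-lightlike ($r>0$) if $x\mapsto \mathrm{Rad}\,T_xM$ is a smooth distribution $\mathrm{Rad}\,TM$ of constant rank $r$. A screen distribution $S(TM)$ is a complement of $\mathrm{Rad}\,TM$ in $TM$; a screen transversal bundle $S(TM^{\widetilde\bot})$ is a complement of $\mathrm{Rad}\,TM$ in $TM^{\widetilde\bot}$; both are non-degenerate for $\overline{\widetilde g}$ and are mutually orthogonal. Let $E$ be the $\overline{\widetilde g}$-orthogonal complement of $S(TM)\oplus S(TM^{\widetilde\bot})$ in $T\overline M|_M$; it contains $\mathrm{Rad}\,TM$ and has rank $2r$. A lightlike transversal bundle $\mathrm{ltr}(TM)$ is a complement of $\mathrm{Rad}\,TM$ in $E$ that is totally null for $\overline{\widetilde g}$ (locally it has a frame $N_i$ with $\overline{\widetilde g}(N_i,\xi_j)=\delta_{ij}$, $\overline{\widetilde g}(N_i,N_j)=0$ for a frame $\xi_j$ of $\mathrm{Rad}\,TM$). $(M,\widetilde g)$ is a Radical transversal lightlike submanifold if it is a lightlike submanifold with screen distribution $S(TM)$, screen transversal bundle $S(TM^{\widetilde\bot})$ and lightlike transversal bundle $\mathrm{ltr}(TM)$ (for some choice of these) such that $\overline J(\mathrm{Rad}\,TM)=\mathrm{ltr}(TM)$ and $\overline J(S(TM))=S(TM)$. The case $S(TM)=0$ is allowed. *)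

theory Defs
  imports "HOL-Analysis.Analysis" "HOL-Library.Function_Algebras"
begin

section \<open>Smooth maps between Euclidean spaces\<close>

text \<open>
  Only used for open \<open>S\<close>. In finite dimension, being \<open>C\<^sup>k\<^sup>+\<^sup>1\<close> means being differentiable with all
  directional derivatives of class \<open>C\<^sup>k\<close>.
\<close>

primrec Ck_on :: "nat \<Rightarrow> 'e::euclidean_space set \<Rightarrow> ('e \<Rightarrow> 'b::real_normed_vector) \<Rightarrow> bool" where
  "Ck_on 0 S f \<longleftrightarrow> continuous_on S f"
| "Ck_on (Suc k) S f \<longleftrightarrow> (\<forall>x\<in>S. f differentiable (at x)) \<and>
     (\<forall>v. Ck_on k S (\<lambda>x. frechet_derivative f (at x) v))"

definition smooth_on :: "'e::euclidean_space set \<Rightarrow> ('e \<Rightarrow> 'b::real_normed_vector) \<Rightarrow> bool" where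
  "smooth_on S f \<longleftrightarrow> (\<forall>k. Ck_on k S f)"

section \<open>Smooth manifolds\<close>

datatype ('a, 'e) chart = Chart (cdom: "'a set") (cmap: "'a \<Rightarrow> 'e")

definition cinv :: "('a, 'e) chart \<Rightarrow> 'e \<Rightarrow> 'a" where
  "cinv c = inv_into (cdom c) (cmap c)"

text \<open>
  The topology is carried explicitly (not by a type class), so that a submanifold can consist of
  points of the ambient manifold and still have its own topology. The dimension is \<open>DIM('e)\<close>.
  The atlas need not be maximal; none of the notions below depends on which of the compatible
  atlases is chosen.
\<close>

record ('a, 'e) manifold =
  topo :: "'a topology"
  atlas :: "('a, 'e) chart set"

abbreviation points :: "('a, 'e) manifold \<Rightarrow> 'a set" where
  "points M \<equiv> topspace (topo M)"

definition smooth_manifold :: "('a, 'e::euclidean_space) manifold \<Rightarrow> bool" where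
  "smooth_manifold M \<longleftrightarrow>
     Hausdorff_space (topo M) \<and> second_countable (topo M) \<and>
     points M = (\<Union>c\<in>atlas M. cdom c) \<and>
     (\<forall>c\<in>atlas M. openin (topo M) (cdom c) \<and> open (cmap c ` cdom c) \<and>
        homeomorphic_map (subtopology (topo M) (cdom c)) (top_of_set (cmap c ` cdom c)) (cmap c)) \<and>
     (\<forall>c\<in>atlas M. \<forall>d\<in>atlas M. smooth_on (cmap c ` (cdom c \<inter> cdom d)) (cmap d \<circ> cinv c))"

definition charts_at :: "('a, 'e) manifold \<Rightarrow> 'a \<Rightarrow> ('a, 'e) chart set" where
  "charts_at M x = {c \<in> atlas M. x \<in> cdom c}"

section \<open>Tangent vectors\<close>

text \<open>
  A tangent vector at \<open>x\<close> is the family of its coordinate vectors in all charts around \<open>x\<close>, related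
  by the derivatives of the coordinate changes. Charts that are not around \<open>x\<close> get the value \<open>0\<close>,
  so that equality is equality of tangent vectors and the vector space operations are pointwise.
\<close>

instantiation "fun" :: (type, real_vector) real_vector
begin

definition scaleR_fun :: "real \<Rightarrow> ('a \<Rightarrow> 'b) \<Rightarrow> 'a \<Rightarrow> 'b" where
  "scaleR_fun r f = (\<lambda>x. r *\<^sub>R f x)"

instance
  by standard (auto simp: scaleR_fun_def plus_fun_def algebra_simps)

end

type_synonym ('a, 'e) tvec = "('a, 'e) chart \<Rightarrow> 'e"

definition tangent_space :: "('a, 'e::euclidean_space) manifold \<Rightarrow> 'a \<Rightarrow> ('a, 'e) tvec set" where
  "tangent_space M x = {v.
     (\<forall>c. c \<notin> charts_at M x \<longrightarrow> v c = 0) \<and>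
     (\<forall>c\<in>charts_at M x. \<forall>d\<in>charts_at M x.
        v d = frechet_derivative (cmap d \<circ> cinv c) (at (cmap c x)) (v c))}"

definition smooth_map ::
  "('a, 'f::euclidean_space) manifold \<Rightarrow> ('b, 'e::euclidean_space) manifold \<Rightarrow> ('a \<Rightarrow> 'b) \<Rightarrow> bool" where
  "smooth_map M N f \<longleftrightarrow> continuous_map (topo M) (topo N) f \<and>
     (\<forall>c\<in>atlas M. \<forall>d\<in>atlas N.
        smooth_on (cmap c ` (cdom c \<inter> f -` cdom d)) (cmap d \<circ> f \<circ> cinv c))"

text \<open>For smooth \<open>f\<close> and \<open>v\<close> tangent to \<open>M\<close>, the choice of the chart \<open>c\<close> is irrelevant by the chain rule.\<close>

definition differential ::
  "('a, 'f::euclidean_space) manifold \<Rightarrow> ('b, 'e::euclidean_space) manifold \<Rightarrow> ('a \<Rightarrow> 'b) \<Rightarrow> 'a \<Rightarrow>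
   ('a, 'f) tvec \<Rightarrow> ('b, 'e) tvec" where
  "differential M N f x v = (\<lambda>d.
     if d \<in> charts_at N (f x)
     then (let c = (SOME c. c \<in> charts_at M x)
           in frechet_derivative (cmap d \<circ> f \<circ> cinv c) (at (cmap c x)) (v c))
     else 0)"

text \<open>
  A submanifold is a subset with its own manifold structure for which the inclusion is an immersion.
\<close>

definition submanifold ::
  "('a, 'f::euclidean_space) manifold \<Rightarrow> ('a, 'e::euclidean_space) manifold \<Rightarrow> bool" where
  "submanifold M N \<longleftrightarrow>
     smooth_manifold M \<and> smooth_manifold N \<and> points M \<subseteq> points N \<and> smooth_map M N id \<and>
     (\<forall>x\<in>points M. inj_on (differential M N id x) (tangent_space M x))"

text \<open>\<open>T\<^sub>xM\<close> as a subspace of \<open>T\<^sub>xN\<close>.\<close>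

definition sub_tangent_space ::
  "('a, 'f::euclidean_space) manifold \<Rightarrow> ('a, 'e::euclidean_space) manifold \<Rightarrow> 'a \<Rightarrow> ('a, 'e) tvec set" where
  "sub_tangent_space M N x = differential M N id x ` tangent_space M x"

section \<open>Smooth sections and subbundles\<close>

definition smooth_function ::
  "('a, 'e::euclidean_space) manifold \<Rightarrow> 'a set \<Rightarrow> ('a \<Rightarrow> real) \<Rightarrow> bool" where
  "smooth_function M U f \<longleftrightarrow> (\<forall>c\<in>atlas M. smooth_on (cmap c ` (U \<inter> cdom c)) (f \<circ> cinv c))"

text \<open>
  Smooth sections of \<open>TN|\<^sub>M\<close> over an open subset \<open>U\<close> of the submanifold \<open>M\<close>.
  For \<open>M = N\<close> these are the smooth vector fields on \<open>U\<close>.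
\<close>

definition smooth_section ::
  "('a, 'f::euclidean_space) manifold \<Rightarrow> ('a, 'e::euclidean_space) manifold \<Rightarrow> 'a set \<Rightarrow>
   ('a \<Rightarrow> ('a, 'e) tvec) \<Rightarrow> bool" where
  "smooth_section M N U V \<longleftrightarrow>
     (\<forall>x\<in>U. V x \<in> tangent_space N x) \<and>
     (\<forall>c\<in>atlas M. \<forall>d\<in>atlas N.
        smooth_on (cmap c ` (U \<inter> cdom c \<inter> cdom d)) (\<lambda>y. V (cinv c y) d))"

text \<open>
  Smooth subbundles of rank \<open>k\<close> of \<open>TN|\<^sub>M\<close>, given by local smooth frames.
  For \<open>M = N\<close> these are the smooth distributions of rank \<open>k\<close> on \<open>M\<close>.
\<close>

definition smooth_subbundle ::
  "('a, 'f::euclidean_space) manifold \<Rightarrow> ('a, 'e::euclidean_space) manifold \<Rightarrow> nat \<Rightarrow>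
   ('a \<Rightarrow> ('a, 'e) tvec set) \<Rightarrow> bool" where
  "smooth_subbundle M N k E \<longleftrightarrow>
     (\<forall>x\<in>points M. \<exists>U. openin (topo M) U \<and> x \<in> U \<and>
        (\<exists>s :: nat \<Rightarrow> 'a \<Rightarrow> ('a, 'e) tvec.
           (\<forall>i<k. smooth_section M N U (s i)) \<and>
           (\<forall>p\<in>U. inj_on (\<lambda>i. s i p) {..<k} \<and> independent ((\<lambda>i. s i p) ` {..<k}) \<and>
                   E p = span ((\<lambda>i. s i p) ` {..<k}))))"

text \<open>Smooth distributions of rank \<open>k\<close> on \<open>M\<close>, regarded as subspaces of the spaces \<open>T\<^sub>xN\<close>.\<close>

definition distribution_on ::
  "('a, 'f::euclidean_space) manifold \<Rightarrow> ('a, 'e::euclidean_space) manifold \<Rightarrow> nat \<Rightarrow>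
   ('a \<Rightarrow> ('a, 'e) tvec set) \<Rightarrow> bool" where
  "distribution_on M N k D \<longleftrightarrow>
     (\<exists>D'. smooth_subbundle M M k D' \<and>
        (\<forall>x\<in>points M. D x = differential M N id x ` D' x))"

section \<open>Almost complex manifolds with Norden metric\<close>

definition linear_map_on :: "'v::real_vector set \<Rightarrow> 'w::real_vector set \<Rightarrow> ('v \<Rightarrow> 'w) \<Rightarrow> bool" where
  "linear_map_on V W h \<longleftrightarrow> (\<forall>u\<in>V. h u \<in> W) \<and>
     (\<forall>u\<in>V. \<forall>v\<in>V. h (u + v) = h u + h v) \<and> (\<forall>a. \<forall>u\<in>V. h (a *\<^sub>R u) = a *\<^sub>R h u)"

definition symmetric_form_on :: "'v::real_vector set \<Rightarrow> ('v \<Rightarrow> 'v \<Rightarrow> real) \<Rightarrow> bool" where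
  "symmetric_form_on V b \<longleftrightarrow>
     (\<forall>u\<in>V. linear_map_on V UNIV (b u)) \<and> (\<forall>u\<in>V. \<forall>v\<in>V. b u v = b v u)"

definition nondegenerate_on :: "'v::real_vector set \<Rightarrow> ('v \<Rightarrow> 'v \<Rightarrow> real) \<Rightarrow> bool" where
  "nondegenerate_on V b \<longleftrightarrow> (\<forall>u\<in>V. (\<forall>v\<in>V. b u v = 0) \<longrightarrow> u = 0)"

definition form_index :: "'v::real_vector set \<Rightarrow> ('v \<Rightarrow> 'v \<Rightarrow> real) \<Rightarrow> nat" where
  "form_index V b = Max {dim W |W. subspace W \<and> W \<subseteq> V \<and> (\<forall>w\<in>W. w \<noteq> 0 \<longrightarrow> b w w < 0)}"

type_synonym ('a, 'e) endo_field = "'a \<Rightarrow> ('a, 'e) tvec \<Rightarrow> ('a, 'e) tvec"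
type_synonym ('a, 'e) form_field = "'a \<Rightarrow> ('a, 'e) tvec \<Rightarrow> ('a, 'e) tvec \<Rightarrow> real"

text \<open>Tensor fields are smooth if they take smooth local vector fields to smooth objects.\<close>

definition almost_complex_structure ::
  "('a, 'e::euclidean_space) manifold \<Rightarrow> ('a, 'e) endo_field \<Rightarrow> bool" where
  "almost_complex_structure N J \<longleftrightarrow>
     (\<forall>x\<in>points N. linear_map_on (tangent_space N x) (tangent_space N x) (J x) \<and>
        (\<forall>v\<in>tangent_space N x. J x (J x v) = - v)) \<and>
     (\<forall>U V. openin (topo N) U \<and> smooth_section N N U V \<longrightarrow> smooth_section N N U (\<lambda>x. J x (V x)))"

definition semi_riemannian_metric ::
  "('a, 'e::euclidean_space) manifold \<Rightarrow> ('a, 'e) form_field \<Rightarrow> bool" where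
  "semi_riemannian_metric N g \<longleftrightarrow>
     (\<forall>x\<in>points N. symmetric_form_on (tangent_space N x) (g x) \<and>
        nondegenerate_on (tangent_space N x) (g x)) \<and>
     (\<forall>U V W. openin (topo N) U \<and> smooth_section N N U V \<and> smooth_section N N U W \<longrightarrow>
        smooth_function N U (\<lambda>x. g x (V x) (W x))) \<and>
     (\<exists>\<nu>. \<forall>x\<in>points N. form_index (tangent_space N x) (g x) = \<nu>)"

definition almost_complex_norden_manifold ::
  "('a, 'e::euclidean_space) manifold \<Rightarrow> ('a, 'e) endo_field \<Rightarrow> ('a, 'e) form_field \<Rightarrow> bool" where
  "almost_complex_norden_manifold N J g \<longleftrightarrow>
     smooth_manifold N \<and> almost_complex_structure N J \<and> semi_riemannian_metric N g \<and>
     (\<forall>x\<in>points N. \<forall>u\<in>tangent_space N x. \<forall>v\<in>tangent_space N x. g x (J x u) (J x v) = - g x u v)"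

definition associated_metric ::
  "('a, 'e) endo_field \<Rightarrow> ('a, 'e) form_field \<Rightarrow> ('a, 'e) form_field" where
  "associated_metric J g x u v = g x (J x u) v"

section \<open>CR-submanifolds\<close>

definition orth :: "('v \<Rightarrow> 'v \<Rightarrow> real) \<Rightarrow> 'v set \<Rightarrow> 'v set \<Rightarrow> 'v set" where
  "orth b V W = {v \<in> V. \<forall>w\<in>W. b v w = 0}"

definition direct_sum :: "'v::real_vector set \<Rightarrow> 'v set \<Rightarrow> 'v set \<Rightarrow> bool" where
  "direct_sum V A B \<longleftrightarrow> V = {a + b |a b. a \<in> A \<and> b \<in> B} \<and> A \<inter> B = {0}"

text \<open>The orthogonal bundle of \<open>TM\<close> in \<open>TN|\<^sub>M\<close> with respect to the metric \<open>h\<close> on \<open>N\<close>.\<close>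

definition normal_space ::
  "('a, 'f::euclidean_space) manifold \<Rightarrow> ('a, 'e::euclidean_space) manifold \<Rightarrow> ('a, 'e) form_field \<Rightarrow>
   'a \<Rightarrow> ('a, 'e) tvec set" where
  "normal_space M N h x = orth (h x) (tangent_space N x) (sub_tangent_space M N x)"

definition CR_submanifold ::
  "('a, 'f::euclidean_space) manifold \<Rightarrow> ('a, 'e::euclidean_space) manifold \<Rightarrow> ('a, 'e) endo_field \<Rightarrow>
   ('a, 'e) form_field \<Rightarrow> ('a \<Rightarrow> ('a, 'e) tvec set) \<Rightarrow> ('a \<Rightarrow> ('a, 'e) tvec set) \<Rightarrow> bool" where
  "CR_submanifold M N J g D Dperp \<longleftrightarrow>
     submanifold M N \<and>
     (\<exists>k. distribution_on M N k D) \<and> (\<exists>k. distribution_on M N k Dperp) \<and>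
     (\<forall>x\<in>points M.
        nondegenerate_on (sub_tangent_space M N x) (g x) \<and>
        direct_sum (sub_tangent_space M N x) (D x) (Dperp x) \<and>
        (\<forall>u\<in>D x. \<forall>v\<in>Dperp x. g x u v = 0) \<and>
        J x ` D x = D x \<and>
        J x ` Dperp x \<subseteq> normal_space M N g x)"

section \<open>Lightlike submanifolds\<close>

text \<open>In this section \<open>h\<close> is the metric on \<open>N\<close> with respect to which \<open>M\<close> is lightlike.\<close>

definition Rad ::
  "('a, 'f::euclidean_space) manifold \<Rightarrow> ('a, 'e::euclidean_space) manifold \<Rightarrow> ('a, 'e) form_field \<Rightarrow>
   'a \<Rightarrow> ('a, 'e) tvec set" where
  "Rad M N h x = sub_tangent_space M N x \<inter> normal_space M N h x"

definition lightlike_submanifold ::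
  "nat \<Rightarrow> ('a, 'f::euclidean_space) manifold \<Rightarrow> ('a, 'e::euclidean_space) manifold \<Rightarrow>
   ('a, 'e) form_field \<Rightarrow> bool" where
  "lightlike_submanifold r M N h \<longleftrightarrow>
     submanifold M N \<and> r > 0 \<and> distribution_on M N r (Rad M N h)"

definition screen_distribution ::
  "('a, 'f::euclidean_space) manifold \<Rightarrow> ('a, 'e::euclidean_space) manifold \<Rightarrow> ('a, 'e) form_field \<Rightarrow>
   ('a \<Rightarrow> ('a, 'e) tvec set) \<Rightarrow> bool" where
  "screen_distribution M N h S \<longleftrightarrow>
     (\<exists>k. distribution_on M N k S) \<and>
     (\<forall>x\<in>points M.
        direct_sum (sub_tangent_space M N x) (Rad M N h x) (S x) \<and> nondegenerate_on (S x) (h x))"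

definition screen_transversal_bundle ::
  "('a, 'f::euclidean_space) manifold \<Rightarrow> ('a, 'e::euclidean_space) manifold \<Rightarrow> ('a, 'e) form_field \<Rightarrow>
   ('a \<Rightarrow> ('a, 'e) tvec set) \<Rightarrow> bool" where
  "screen_transversal_bundle M N h ST \<longleftrightarrow>
     (\<exists>k. smooth_subbundle M N k ST) \<and>
     (\<forall>x\<in>points M.
        direct_sum (normal_space M N h x) (Rad M N h x) (ST x) \<and> nondegenerate_on (ST x) (h x))"

text \<open>
  \<open>S\<close> and \<open>ST\<close> are orthogonal to each other automatically, as \<open>S x\<close> lies in \<open>T\<^sub>xM\<close> and \<open>ST x\<close> in its
  orthogonal space.
\<close>

definition lightlike_transversal_bundle ::
  "('a, 'f::euclidean_space) manifold \<Rightarrow> ('a, 'e::euclidean_space) manifold \<Rightarrow> ('a, 'e) form_field \<Rightarrow>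
   ('a \<Rightarrow> ('a, 'e) tvec set) \<Rightarrow> ('a \<Rightarrow> ('a, 'e) tvec set) \<Rightarrow> ('a \<Rightarrow> ('a, 'e) tvec set) \<Rightarrow> bool" where
  "lightlike_transversal_bundle M N h S ST ltr \<longleftrightarrow>
     (\<exists>k. smooth_subbundle M N k ltr) \<and>
     (\<forall>x\<in>points M.
        direct_sum (orth (h x) (tangent_space N x) {u + v |u v. u \<in> S x \<and> v \<in> ST x})
          (Rad M N h x) (ltr x) \<and>
        (\<forall>u\<in>ltr x. \<forall>v\<in>ltr x. h x u v = 0))"

definition radical_transversal_lightlike_submanifold ::
  "nat \<Rightarrow> ('a, 'f::euclidean_space) manifold \<Rightarrow> ('a, 'e::euclidean_space) manifold \<Rightarrow>
   ('a, 'e) endo_field \<Rightarrow> ('a, 'e) form_field \<Rightarrow> bool" where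
  "radical_transversal_lightlike_submanifold r M N J h \<longleftrightarrow>
     lightlike_submanifold r M N h \<and>
     (\<exists>S ST ltr. screen_distribution M N h S \<and> screen_transversal_bundle M N h ST \<and>
        lightlike_transversal_bundle M N h S ST ltr \<and>
        (\<forall>x\<in>points M. J x ` Rad M N h x = ltr x \<and> J x ` S x = S x))"

end

theory Submission
  imports Defs
begin

text \<open>
  Write \<open>h u v = g (J u) v\<close> for the associated metric. As \<open>J\<close> is self-adjoint for \<open>g\<close>, a vector \<open>v\<close> is
  \<open>h\<close>-orthogonal to \<open>TM\<close> iff \<open>J v\<close> is \<open>g\<close>-orthogonal to \<open>TM\<close>. So the radical of \<open>h\<close> on \<open>TM\<close> consists of the
  tangent vectors that \<open>J\<close> maps to \<open>g\<close>-normal vectors, which is the defining property of the totally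
  real distribution. Both structures are the same splitting of \<open>TM\<close>: the screen distribution corresponds to
  the \<open>J\<close>-invariant distribution \<open>D\<close>, and the radical to the totally real distribution \<open>P\<close>.

  If \<open>M\<close> is a CR-submanifold, then \<open>TN\<close> along \<open>M\<close> is the \<open>g\<close>-orthogonal sum of \<open>D\<close>, \<open>P\<close>, \<open>J P\<close> and a
  \<open>J\<close>-invariant bundle \<open>K\<close>. For \<open>h\<close>, the invariant bundles \<open>D\<close> and \<open>K\<close> stay nondegenerate, while \<open>P\<close>
  and \<open>J P\<close> become null. Thus \<open>D\<close>, \<open>K\<close> and \<open>J P\<close> are a screen distribution, a screen transversal bundle
  and a lightlike transversal bundle. Conversely, the screen and the radical form a CR-structure; the point is
  that \<open>g\<close> is nondegenerate on \<open>TM\<close>, which holds because the lightlike transversal bundle \<open>J (Rad TM)\<close> is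
  paired nondegenerately with the radical. The pointwise arguments are \<open>CR_imp_radical\<close> and
  \<open>radical_imp_CR\<close>.

  The remaining work is smoothness. A distribution on \<open>M\<close> is a smooth subbundle of \<open>TN\<close> along \<open>M\<close>
  (\<open>distribution_subbundle\<close>), \<open>J\<close> preserves smooth sections along \<open>M\<close> (\<open>smooth_section_J\<close>), and \<open>K\<close>, an
  orthogonal complement, has smooth local frames (\<open>local_frame_orth\<close>). The latter are obtained by
  Gaussian elimination, which also works for an indefinite metric, where orthonormalizing a given frame
  can fail.
\<close>

section \<open>Calculus of smooth maps\<close>

lemma Ck_on_cong:
  assumes "open S" "\<And>x. x \<in> S \<Longrightarrow> f x = f' x" "Ck_on k S f"
  shows "Ck_on k S f'"
  using assms(2,3)
proof (induction k arbitrary: f f')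
  case 0
  then show ?case using continuous_on_cong[of S S f f'] by simp
next
  case (Suc k)
  have D: "f' differentiable at x" "frechet_derivative f (at x) = frechet_derivative f' (at x)"
    if "x \<in> S" for x
  proof -
    have "(f has_derivative frechet_derivative f (at x)) (at x)"
      using Suc.prems that frechet_derivative_works by auto
    then have *: "(f' has_derivative frechet_derivative f (at x)) (at x)"
      using has_derivative_transform_within_open[OF _ assms(1) that] Suc.prems(1) by blast
    then show "f' differentiable at x" "frechet_derivative f (at x) = frechet_derivative f' (at x)"
      using frechet_derivative_at by (auto simp: differentiable_def)
  qed
  have "Ck_on k S (\<lambda>x. frechet_derivative f' (at x) v)" for v
    by (rule Suc.IH[of "\<lambda>x. frechet_derivative f (at x) v"]) (use D(2) Suc.prems(2) in auto)
  with D(1) show ?case by simp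
qed

lemma Ck_on_subset: "Ck_on k S f \<Longrightarrow> S' \<subseteq> S \<Longrightarrow> Ck_on k S' f"
proof (induction k arbitrary: f)
  case 0
  then show ?case using continuous_on_subset[of S f S'] by simp
next
  case (Suc k)
  have "Ck_on k S' (\<lambda>x. frechet_derivative f (at x) v)" for v
    using Suc.prems by (intro Suc.IH) simp_all
  with Suc.prems show ?case by auto
qed

lemma Ck_on_SucD: "Ck_on (Suc k) S f \<Longrightarrow> Ck_on k S f"
proof (induction k arbitrary: f)
  case 0
  then show ?case
    by (auto intro!: continuous_at_imp_continuous_on differentiable_imp_continuous_within)
next
  case (Suc k)
  show ?case
    unfolding Ck_on.simps(2)[of k]
    using Suc.prems Suc.IH by (auto simp del: Ck_on.simps(2) simp: Ck_on.simps(2)[of "Suc k"])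
qed

text \<open>
  Induction on \<open>k\<close> works with any explicit formula for the derivative, since
  \<^const>\<open>frechet_derivative\<close> agrees with it on the open set. All closure properties below are instances.
\<close>

lemma Ck_on_SucI:
  assumes "open S" "\<And>x. x \<in> S \<Longrightarrow> (f has_derivative f' x) (at x)" "\<And>v. Ck_on k S (\<lambda>x. f' x v)"
  shows "Ck_on (Suc k) S f"
proof -
  have "f' x = frechet_derivative f (at x)" if "x \<in> S" for x
    using assms(2)[OF that] frechet_derivative_at by auto
  then have "Ck_on k S (\<lambda>x. frechet_derivative f (at x) v)" for v
    by (intro Ck_on_cong[OF assms(1) _ assms(3)[of v]]) simp
  then show ?thesis using assms(2) by (auto simp: differentiable_def)
qed

lemma Ck_on_SucE:
  assumes "Ck_on (Suc k) S f" "x \<in> S"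
  shows "(f has_derivative frechet_derivative f (at x)) (at x)"
  using assms frechet_derivative_works by auto

lemma Ck_on_const: "open S \<Longrightarrow> Ck_on k S (\<lambda>x. c)"
proof (induction k arbitrary: c)
  case (Suc k)
  show ?case
    by (rule Ck_on_SucI[OF Suc.prems, where f' = "\<lambda>x v. 0"])
       (rule has_derivative_const, rule Suc.IH[OF Suc.prems])
qed simp

lemma Ck_on_add: "open S \<Longrightarrow> Ck_on k S f \<Longrightarrow> Ck_on k S f' \<Longrightarrow> Ck_on k S (\<lambda>x. f x + f' x)"
proof (induction k arbitrary: f f')
  case (Suc k)
  show ?case
  proof (rule Ck_on_SucI[OF Suc.prems(1)])
    show "((\<lambda>x. f x + f' x) has_derivative
        (\<lambda>v. frechet_derivative f (at x) v + frechet_derivative f' (at x) v)) (at x)" if "x \<in> S" for x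
      by (intro has_derivative_add Ck_on_SucE[OF Suc.prems(2) that] Ck_on_SucE[OF Suc.prems(3) that])
    show "Ck_on k S (\<lambda>x. frechet_derivative f (at x) v + frechet_derivative f' (at x) v)" for v
      using Suc.prems(2,3) by (intro Suc.IH Suc.prems(1)) simp_all
  qed
qed (simp add: continuous_on_add)

lemma Ck_on_bilinear:
  assumes "bounded_bilinear b" "open S"
  shows "Ck_on k S f \<Longrightarrow> Ck_on k S f' \<Longrightarrow> Ck_on k S (\<lambda>x. b (f x) (f' x))"
proof (induction k arbitrary: f f')
  case 0
  then show ?case using bounded_bilinear.continuous_on[OF assms(1)] by auto
next
  case (Suc k)
  note f = Suc.prems Suc.prems[THEN Ck_on_SucD]
  show ?case
  proof (rule Ck_on_SucI[OF assms(2)])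
    show "((\<lambda>x. b (f x) (f' x)) has_derivative
        (\<lambda>v. b (f x) (frechet_derivative f' (at x) v) + b (frechet_derivative f (at x) v) (f' x))) (at x)"
      if "x \<in> S" for x
      by (intro bounded_bilinear.FDERIV[OF assms(1)] Ck_on_SucE[OF f(1) that] Ck_on_SucE[OF f(2) that])
    show "Ck_on k S (\<lambda>x. b (f x) (frechet_derivative f' (at x) v) + b (frechet_derivative f (at x) v) (f' x))"
      for v using f(1,2) by (intro Ck_on_add[OF assms(2)] Suc.IH f(3,4)) simp_all
  qed
qed

lemma Ck_on_sum:
  "open S \<Longrightarrow> (\<And>i. i \<in> I \<Longrightarrow> Ck_on k S (f i)) \<Longrightarrow> Ck_on k S (\<lambda>x. \<Sum>i\<in>I. f i x)"
  by (induction I rule: infinite_finite_induct) (auto intro!: Ck_on_const Ck_on_add)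

lemma Ck_on_inverse:
  fixes f :: "'e::euclidean_space \<Rightarrow> real"
  assumes "open S" "\<And>x. x \<in> S \<Longrightarrow> f x \<noteq> 0"
  shows "Ck_on k S f \<Longrightarrow> Ck_on k S (\<lambda>x. inverse (f x))"
proof (induction k)
  case 0
  then show ?case using assms(2) by (simp add: continuous_on_inverse)
next
  case (Suc k)
  note I = Suc.IH[OF Suc.prems[THEN Ck_on_SucD]]
  show ?case
  proof (rule Ck_on_SucI[OF assms(1)])
    show "((\<lambda>x. inverse (f x)) has_derivative
        (\<lambda>v. (-1) * (inverse (f x) * (frechet_derivative f (at x) v * inverse (f x))))) (at x)"
      if "x \<in> S" for x
      using Deriv.has_derivative_inverse[OF assms(2)[OF that] Ck_on_SucE[OF Suc.prems that]]
      by (simp add: mult.assoc)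
    show "Ck_on k S (\<lambda>x. (-1) * (inverse (f x) * (frechet_derivative f (at x) v * inverse (f x))))" for v
      using Suc.prems
      by (intro Ck_on_bilinear[OF bounded_bilinear_mult] assms(1) I Ck_on_const) auto
  qed
qed

lemma linear_euclidean_expand:
  fixes L :: "'e::euclidean_space \<Rightarrow> 'b::real_vector"
  assumes "linear L" shows "L v = (\<Sum>b\<in>Basis. (v \<bullet> b) *\<^sub>R L b)"
proof -
  have "L v = L (\<Sum>b\<in>Basis. (v \<bullet> b) *\<^sub>R b)" by (simp add: euclidean_representation)
  then show ?thesis by (simp only: linear_sum[OF assms] linear_scale[OF assms])
qed

text \<open>
  The definition controls the derivative only in a fixed direction. A direction that varies smoothly
  is reduced to this case by expanding it in the standard basis. The base point is moved by a
  map \<open>q\<close> so that the lemma also serves the induction for the chain rule.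
\<close>

lemma Ck_on_apply_derivative:
  fixes f :: "'e::euclidean_space \<Rightarrow> 'b::real_normed_vector" and w :: "'d::euclidean_space \<Rightarrow> 'e"
  assumes "open S" "\<And>x. x \<in> S \<Longrightarrow> f differentiable at (q x)"
    and "\<And>b. b \<in> Basis \<Longrightarrow> Ck_on k S (\<lambda>x. frechet_derivative f (at (q x)) b)" "Ck_on k S w"
  shows "Ck_on k S (\<lambda>x. frechet_derivative f (at (q x)) (w x))"
proof (rule Ck_on_cong[OF assms(1)])
  show "(\<Sum>b\<in>Basis. (w x \<bullet> b) *\<^sub>R frechet_derivative f (at (q x)) b) =
      frechet_derivative f (at (q x)) (w x)" if "x \<in> S" for x
    by (rule linear_euclidean_expand[OF linear_frechet_derivative[OF assms(2)[OF that]], symmetric])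
  show "Ck_on k S (\<lambda>x. \<Sum>b\<in>Basis. (w x \<bullet> b) *\<^sub>R frechet_derivative f (at (q x)) b)"
    by (intro Ck_on_sum assms(1) Ck_on_bilinear[OF bounded_bilinear_scaleR]
        Ck_on_bilinear[OF bounded_bilinear_inner] Ck_on_const assms(3,4))
qed

lemma Ck_on_compose:
  fixes f :: "'e::euclidean_space \<Rightarrow> 'b::real_normed_vector" and q :: "'d::euclidean_space \<Rightarrow> 'e"
  assumes "open S" "open S'" "q ` S \<subseteq> S'"
  shows "Ck_on k S q \<Longrightarrow> Ck_on k S' f \<Longrightarrow> Ck_on k S (f \<circ> q)"
proof (induction k arbitrary: f)
  case 0
  then show ?case using continuous_on_compose[of S q f] continuous_on_subset[of S' f "q ` S"] assms(3) by simp
next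
  case (Suc k)
  show ?case
  proof (rule Ck_on_SucI[OF assms(1)])
    fix x assume x: "x \<in> S"
    with assms(3) have "q x \<in> S'" by auto
    from diff_chain_at[OF Ck_on_SucE[OF Suc.prems(1) x] Ck_on_SucE[OF Suc.prems(2) this]]
    show "((f \<circ> q) has_derivative
        (\<lambda>v. frechet_derivative f (at (q x)) (frechet_derivative q (at x) v))) (at x)"
      by (simp add: o_def)
  next
    fix v
    show "Ck_on k S (\<lambda>x. frechet_derivative f (at (q x)) (frechet_derivative q (at x) v))"
    proof (rule Ck_on_apply_derivative[OF assms(1)])
      show "f differentiable at (q x)" if "x \<in> S" for x
        using Suc.prems(2) that assms(3) by auto
      show "Ck_on k S (\<lambda>x. frechet_derivative f (at (q x)) b)" for b
        using Suc.IH[OF Ck_on_SucD[OF Suc.prems(1)], of "\<lambda>x. frechet_derivative f (at x) b"] Suc.prems(2)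
        by (simp add: o_def)
      show "Ck_on k S (\<lambda>x. frechet_derivative q (at x) v)" using Suc.prems(1) by auto
    qed
  qed
qed

text \<open>
  This lets smoothness along a submanifold be tested on the traces of the charts of the ambient
  manifold.
\<close>

lemma Ck_on_Union:
  assumes "\<And>S. S \<in> \<S> \<Longrightarrow> open S"
  shows "(\<And>S. S \<in> \<S> \<Longrightarrow> Ck_on k S f) \<Longrightarrow> Ck_on k (\<Union>\<S>) f"
proof (induction k arbitrary: f)
  case 0
  then show ?case using assms by (auto intro: continuous_on_open_Union)
next
  case (Suc k)
  have "Ck_on k (\<Union>\<S>) (\<lambda>x. frechet_derivative f (at x) v)" for v
    by (rule Suc.IH) (use Suc.prems in simp)
  with Suc.prems show ?case by auto
qed

lemma smooth_on_cong: "open S \<Longrightarrow> (\<And>x. x \<in> S \<Longrightarrow> f x = f' x) \<Longrightarrow> smooth_on S f \<Longrightarrow> smooth_on S f'"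
  using Ck_on_cong[of S f f'] by (simp add: smooth_on_def)

lemma smooth_on_subset: "smooth_on S f \<Longrightarrow> S' \<subseteq> S \<Longrightarrow> smooth_on S' f"
  unfolding smooth_on_def using Ck_on_subset[of _ S f S'] by simp

lemma smooth_on_const: "open S \<Longrightarrow> smooth_on S (\<lambda>x. c)"
  by (simp add: smooth_on_def Ck_on_const)

lemma smooth_on_add: "open S \<Longrightarrow> smooth_on S f \<Longrightarrow> smooth_on S f' \<Longrightarrow> smooth_on S (\<lambda>x. f x + f' x)"
  by (simp add: smooth_on_def Ck_on_add)

lemma smooth_on_bilinear:
  "bounded_bilinear b \<Longrightarrow> open S \<Longrightarrow> smooth_on S f \<Longrightarrow> smooth_on S f' \<Longrightarrow> smooth_on S (\<lambda>x. b (f x) (f' x))"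
  by (simp add: smooth_on_def Ck_on_bilinear)

lemmas smooth_on_scaleR = smooth_on_bilinear[OF bounded_bilinear_scaleR]
  and smooth_on_inner = smooth_on_bilinear[OF bounded_bilinear_inner]
  and smooth_on_mult = smooth_on_bilinear[OF bounded_bilinear_mult]

lemma smooth_on_sum:
  "open S \<Longrightarrow> (\<And>i. i \<in> I \<Longrightarrow> smooth_on S (f i)) \<Longrightarrow> smooth_on S (\<lambda>x. \<Sum>i\<in>I. f i x)"
  by (simp add: smooth_on_def Ck_on_sum)

lemma smooth_on_inverse:
  fixes f :: "'e::euclidean_space \<Rightarrow> real"
  shows "open S \<Longrightarrow> (\<And>x. x \<in> S \<Longrightarrow> f x \<noteq> 0) \<Longrightarrow> smooth_on S f \<Longrightarrow> smooth_on S (\<lambda>x. inverse (f x))"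
  by (simp add: smooth_on_def Ck_on_inverse)

lemma smooth_on_compose:
  fixes f :: "'e::euclidean_space \<Rightarrow> 'b::real_normed_vector" and q :: "'d::euclidean_space \<Rightarrow> 'e"
  shows "open S \<Longrightarrow> open S' \<Longrightarrow> q ` S \<subseteq> S' \<Longrightarrow> smooth_on S q \<Longrightarrow> smooth_on S' f \<Longrightarrow> smooth_on S (f \<circ> q)"
  using Ck_on_compose[of S S' q _ f] by (simp add: smooth_on_def)

lemma smooth_on_Union:
  "(\<And>S. S \<in> \<S> \<Longrightarrow> open S) \<Longrightarrow> (\<And>S. S \<in> \<S> \<Longrightarrow> smooth_on S f) \<Longrightarrow> smooth_on (\<Union>\<S>) f"
  by (simp add: smooth_on_def Ck_on_Union)

lemma smooth_on_differentiable: "smooth_on S f \<Longrightarrow> x \<in> S \<Longrightarrow> f differentiable at x"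
proof -
  assume "smooth_on S f" "x \<in> S"
  then have "Ck_on (Suc 0) S f" by (simp only: smooth_on_def)
  with \<open>x \<in> S\<close> show ?thesis by simp
qed

lemma smooth_on_continuous: "smooth_on S f \<Longrightarrow> continuous_on S f"
  unfolding smooth_on_def by (drule spec[of _ 0]) simp

lemma smooth_on_derivative: "smooth_on S f \<Longrightarrow> smooth_on S (\<lambda>x. frechet_derivative f (at x) v)"
  unfolding smooth_on_def
proof
  fix k assume "\<forall>k. Ck_on k S f"
  then have "Ck_on (Suc k) S f" ..
  then show "Ck_on k S (\<lambda>x. frechet_derivative f (at x) v)" by simp
qed

lemma smooth_on_apply_derivative:
  fixes f :: "'e::euclidean_space \<Rightarrow> 'b::real_normed_vector"
  assumes "open S" "smooth_on S f" "smooth_on S w"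
  shows "smooth_on S (\<lambda>x. frechet_derivative f (at x) (w x))"
  unfolding smooth_on_def
proof
  fix k
  show "Ck_on k S (\<lambda>x. frechet_derivative f (at x) (w x))"
  proof (rule Ck_on_apply_derivative[of S f "\<lambda>x. x" k w])
    show "Ck_on k S (\<lambda>x. frechet_derivative f (at x) b)" for b
      using smooth_on_derivative[OF assms(2)] by (simp add: smooth_on_def)
    show "Ck_on k S w" using assms(3) by (simp add: smooth_on_def)
  qed (use assms smooth_on_differentiable in auto)
qed

section \<open>Frames, functionals and symmetric forms\<close>

lemma linear_map_on_add: "linear_map_on V W h \<Longrightarrow> u \<in> V \<Longrightarrow> v \<in> V \<Longrightarrow> h (u + v) = h u + h v"
  and linear_map_on_scale: "linear_map_on V W h \<Longrightarrow> u \<in> V \<Longrightarrow> h (a *\<^sub>R u) = a *\<^sub>R h u"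
  and linear_map_on_in: "linear_map_on V W h \<Longrightarrow> u \<in> V \<Longrightarrow> h u \<in> W"
  by (auto simp: linear_map_on_def)

lemma linear_map_on_zero: "linear_map_on V W h \<Longrightarrow> subspace V \<Longrightarrow> h 0 = 0"
  using linear_map_on_scale[of V W h 0 0] by (simp add: subspace_0)

lemma linear_map_on_minus: "linear_map_on V W h \<Longrightarrow> u \<in> V \<Longrightarrow> h (- u) = - h u"
  using linear_map_on_scale[of V W h u "-1"] by simp

lemma linear_map_on_diff:
  "linear_map_on V W h \<Longrightarrow> subspace V \<Longrightarrow> u \<in> V \<Longrightarrow> v \<in> V \<Longrightarrow> h (u - v) = h u - h v"
  using linear_map_on_add[of V W h u "- v"] linear_map_on_minus[of V W h v] by (simp add: subspace_neg)

lemma linear_map_on_sum: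
  assumes "linear_map_on V W h" "subspace V" "\<And>i. i \<in> I \<Longrightarrow> s i \<in> V"
  shows "h (\<Sum>i\<in>I. c i *\<^sub>R s i) = (\<Sum>i\<in>I. c i *\<^sub>R h (s i))"
  using assms(3)
proof (induction I rule: infinite_finite_induct)
  case (insert i I)
  then show ?case
    using linear_map_on_add[OF assms(1), of "c i *\<^sub>R s i" "\<Sum>i\<in>I. c i *\<^sub>R s i"] assms(2)
    by (auto simp: linear_map_on_scale[OF assms(1)] subspace_scale subspace_sum)
qed (use linear_map_on_zero[OF assms(1,2)] in auto)

text \<open>
  Bases as indexed families with coefficients: arbitrary index sets make it possible to
  remove one member or to join several families without renumbering.
\<close>

definition frame :: "'i set \<Rightarrow> ('i \<Rightarrow> 'v::real_vector) \<Rightarrow> 'v set \<Rightarrow> bool" where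
  "frame I s E \<longleftrightarrow> finite I \<and> (\<forall>c. (\<Sum>i\<in>I. c i *\<^sub>R s i) = 0 \<longrightarrow> (\<forall>i\<in>I. c i = 0)) \<and>
     E = range (\<lambda>c. \<Sum>i\<in>I. c i *\<^sub>R s i)"

lemma span_image_eq_range:
  assumes "finite I"
  shows "span (s ` I) = range (\<lambda>c. \<Sum>i\<in>I. c i *\<^sub>R s i)" (is "_ = ?R")
proof
  have "subspace ?R"
  proof (rule subspaceI)
    show "0 \<in> ?R" by (rule range_eqI[of _ _ "\<lambda>_. 0"]) simp
    show "x + y \<in> ?R" if xy: "x \<in> ?R" "y \<in> ?R" for x y
    proof -
      from xy obtain c d where "x = (\<Sum>i\<in>I. c i *\<^sub>R s i)" "y = (\<Sum>i\<in>I. d i *\<^sub>R s i)" by auto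
      then show ?thesis
        by (intro range_eqI[of _ _ "\<lambda>i. c i + d i"]) (simp add: scaleR_add_left sum.distrib)
    qed
    show "a *\<^sub>R x \<in> ?R" if "x \<in> ?R" for a x
    proof -
      from that obtain c where "x = (\<Sum>i\<in>I. c i *\<^sub>R s i)" by auto
      then show ?thesis
        by (intro range_eqI[of _ _ "\<lambda>i. a * c i"]) (simp add: scaleR_sum_right)
    qed
  qed
  moreover have "s j \<in> ?R" if "j \<in> I" for j
    using assms that
    by (intro range_eqI[of _ _ "\<lambda>i. if i = j then 1 else 0"])
       (simp add: if_distrib[of "\<lambda>r. r *\<^sub>R _"] cong: if_cong)
  ultimately show "span (s ` I) \<subseteq> ?R" by (intro span_minimal) auto
  show "?R \<subseteq> span (s ` I)" by (auto intro!: span_sum span_scale intro: span_base)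
qed

lemma frame_iff:
  assumes "finite I"
  shows "frame I s E \<longleftrightarrow> inj_on s I \<and> independent (s ` I) \<and> E = span (s ` I)"
proof -
  have "(\<forall>c. (\<Sum>i\<in>I. c i *\<^sub>R s i) = 0 \<longrightarrow> (\<forall>i\<in>I. c i = 0)) \<longleftrightarrow> inj_on s I \<and> independent (s ` I)"
    (is "?L \<longleftrightarrow> ?R")
  proof
    assume L: ?L
    have inj: "inj_on s I"
    proof (rule inj_onI, rule ccontr)
      fix i j assume ij: "i \<in> I" "j \<in> I" "s i = s j" "i \<noteq> j"
      define c :: "'a \<Rightarrow> real" where "c l = (if l = i then 1 else 0) - (if l = j then 1 else 0)" for l
      have "(\<Sum>l\<in>I. c l *\<^sub>R s l) = 0"
        using ij assms
        by (simp add: c_def scaleR_diff_left sum_subtractf if_distrib[of "\<lambda>r. r *\<^sub>R _"] cong: if_cong)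
      with L ij have "c i = 0" by blast
      with ij show False by (simp add: c_def)
    qed
    moreover have "independent (s ` I)"
    proof
      assume "dependent (s ` I)"
      then obtain u v where u: "v \<in> s ` I" "u v \<noteq> 0" "(\<Sum>v\<in>s ` I. u v *\<^sub>R v) = 0"
        using dependent_finite[of "s ` I"] assms by auto
      have "(\<Sum>v\<in>s ` I. u v *\<^sub>R v) = (\<Sum>i\<in>I. u (s i) *\<^sub>R s i)"
        by (subst sum.reindex[OF inj]) simp
      with u(3) have "(\<Sum>i\<in>I. u (s i) *\<^sub>R s i) = 0" by simp
      with L[rule_format, of "\<lambda>i. u (s i)"] u show False by auto
    qed
    ultimately show ?R ..
  next
    assume R: ?R
    show ?L
    proof (intro allI impI ballI)
      fix c i assume c: "(\<Sum>i\<in>I. c i *\<^sub>R s i) = 0" and i: "i \<in> I"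
      have "(\<Sum>v\<in>s ` I. c (inv_into I s v) *\<^sub>R v) = (\<Sum>i\<in>I. c i *\<^sub>R s i)"
        using R by (subst sum.reindex) (auto intro!: sum.cong)
      moreover have "\<forall>u. (\<Sum>v\<in>s ` I. u v *\<^sub>R v) = 0 \<longrightarrow> (\<forall>v\<in>s ` I. u v = 0)"
        using R dependent_finite[of "s ` I"] assms by auto
      note this[rule_format, of "\<lambda>v. c (inv_into I s v)" "s i"]
      ultimately show "c i = 0" using c R i by simp
    qed
  qed
  then show ?thesis using span_image_eq_range[OF assms, of s] assms by (auto simp: frame_def)
qed

lemma frame_subspace: "frame I s E \<Longrightarrow> subspace E"
  and frame_span: "frame I s E \<Longrightarrow> E = span (s ` I)"
  and frame_finite: "frame I s E \<Longrightarrow> finite I"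
  and frame_in: "frame I s E \<Longrightarrow> i \<in> I \<Longrightarrow> s i \<in> E"
  using frame_iff[of I s E] by (auto simp: frame_def intro: span_base)

lemma frame_zero: "frame I s E \<Longrightarrow> (\<Sum>i\<in>I. c i *\<^sub>R s i) = 0 \<Longrightarrow> i \<in> I \<Longrightarrow> c i = 0"
  by (auto simp: frame_def)

lemma frame_expand: "frame I s E \<Longrightarrow> v \<in> E \<Longrightarrow> \<exists>c. v = (\<Sum>i\<in>I. c i *\<^sub>R s i)"
  by (auto simp: frame_def)

lemma frameI:
  assumes "finite I" "\<And>c i. (\<Sum>i\<in>I. c i *\<^sub>R s i) = 0 \<Longrightarrow> i \<in> I \<Longrightarrow> c i = 0"
    "subspace E" "\<And>i. i \<in> I \<Longrightarrow> s i \<in> E" "\<And>v. v \<in> E \<Longrightarrow> \<exists>c. v = (\<Sum>i\<in>I. c i *\<^sub>R s i)"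
  shows "frame I s E"
  unfolding frame_def
proof (intro conjI allI impI ballI equalityI subsetI)
  show "v \<in> range (\<lambda>c. \<Sum>i\<in>I. c i *\<^sub>R s i)" if "v \<in> E" for v
    using assms(5)[OF that] by blast
qed (use assms in \<open>auto intro!: subspace_sum subspace_scale\<close>)

lemma frame_reindex:
  assumes "bij_betw \<pi> K I" "frame I s E"
  shows "frame K (\<lambda>k. s (\<pi> k)) E"
proof -
  have I: "finite I" using assms(2) by (rule frame_finite)
  then have K: "finite K" using assms(1) bij_betw_finite by blast
  have "inj_on s I" "independent (s ` I)" "E = span (s ` I)" using assms(2) frame_iff[OF I] by auto
  moreover have "\<pi> ` K = I" "inj_on \<pi> K" using assms(1) by (auto simp: bij_betw_def)
  moreover have "(\<lambda>k. s (\<pi> k)) ` K = s ` \<pi> ` K" by (simp add: image_image)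
  ultimately show ?thesis
    unfolding frame_iff[OF K] using comp_inj_on[of \<pi> K s] by (simp add: o_def)
qed

lemma frame_image:
  assumes "frame I s E" "E \<subseteq> V" "subspace V" "linear_map_on V W L" "inj_on L V"
  shows "frame I (\<lambda>i. L (s i)) (L ` E)"
proof -
  have s: "s i \<in> V" if "i \<in> I" for i using frame_in[OF assms(1) that] assms(2) by auto
  note L = linear_map_on_sum[OF assms(4,3) s, of I]
  show ?thesis
    unfolding frame_def
  proof (intro conjI allI impI ballI)
    fix c i assume "(\<Sum>i\<in>I. c i *\<^sub>R L (s i)) = 0" and i: "i \<in> I"
    then have "L (\<Sum>i\<in>I. c i *\<^sub>R s i) = L 0"
      using L linear_map_on_zero[OF assms(4,3)] by simp
    then have "(\<Sum>i\<in>I. c i *\<^sub>R s i) = 0"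
      by (rule inj_onD[OF assms(5)]) (auto intro!: subspace_sum subspace_scale s assms(3) subspace_0)
    then show "c i = 0" using i by (rule frame_zero[OF assms(1)])
  next
    have "L ` E = range (\<lambda>c. L (\<Sum>i\<in>I. c i *\<^sub>R s i))" using assms(1) by (auto simp: frame_def)
    then show "L ` E = range (\<lambda>c. \<Sum>i\<in>I. c i *\<^sub>R L (s i))" using L by auto
  qed (use assms(1) frame_finite in auto)
qed

text \<open>
  On the common kernel of all but one of the functionals, \<open>\<phi>\<close> is a multiple of the remaining one, and the
  difference is handled by induction. This takes the place of dimension counts and of double
  orthogonal complements.
\<close>

lemma functional_combination:
  fixes f :: "'i \<Rightarrow> 'v::real_vector \<Rightarrow> real"
  assumes V: "subspace V" and "finite I" and f: "\<And>i. i \<in> I \<Longrightarrow> linear_map_on V UNIV (f i)"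
    and "linear_map_on V UNIV \<phi>"
    and "\<And>v. v \<in> V \<Longrightarrow> (\<And>i. i \<in> I \<Longrightarrow> f i v = 0) \<Longrightarrow> \<phi> v = 0"
  shows "\<exists>c. \<forall>v\<in>V. \<phi> v = (\<Sum>i\<in>I. c i * f i v)"
  using assms(2-)
proof (induction I arbitrary: \<phi> rule: finite_induct)
  case empty
  then show ?case by auto
next
  case (insert i I)
  note fi = insert.prems(1)[of i, simplified] and \<phi> = insert.prems(2)
  obtain a where a: "\<phi> v = a * f i v" if "v \<in> V" "\<And>j. j \<in> I \<Longrightarrow> f j v = 0" for v
  proof (cases "\<forall>v\<in>V. (\<forall>j\<in>I. f j v = 0) \<longrightarrow> f i v = 0")
    case True
    then show ?thesis using insert.prems(3) by (intro that[of 0]) auto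
  next
    case False
    then obtain w where w: "w \<in> V" "\<And>j. j \<in> I \<Longrightarrow> f j w = 0" "f i w \<noteq> 0" by auto
    have "\<phi> v = \<phi> w / f i w * f i v" if v: "v \<in> V" "\<And>j. j \<in> I \<Longrightarrow> f j v = 0" for v
    proof -
      let ?t = "f i v / f i w"
      have *: "L (v - ?t *\<^sub>R w) = L v - ?t * L w" if "linear_map_on V UNIV L" for L :: "'v \<Rightarrow> real"
        using linear_map_on_diff[OF that V v(1)] linear_map_on_scale[OF that w(1)] V w(1)
        by (simp add: subspace_scale)
      have "\<phi> (v - ?t *\<^sub>R w) = 0"
        using V v w insert.prems(1)
        by (intro insert.prems(3)) (auto simp: * subspace_diff subspace_scale)
      with *[OF \<phi>] show ?thesis by simp
    qed
    then show ?thesis using that by blast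
  qed
  have "linear_map_on V UNIV (\<lambda>v. \<phi> v - a * f i v)"
    using fi \<phi> by (simp add: linear_map_on_def algebra_simps)
  with insert.IH[of "\<lambda>v. \<phi> v - a * f i v"] insert.prems(1) a
  obtain c where c: "\<phi> v - a * f i v = (\<Sum>j\<in>I. c j * f j v)" if "v \<in> V" for v by auto
  have "\<phi> v = (\<Sum>j\<in>insert i I. (c(i := a)) j * f j v)" if "v \<in> V" for v
  proof -
    have "(\<Sum>j\<in>I. (c(i := a)) j * f j v) = (\<Sum>j\<in>I. c j * f j v)"
      using insert.hyps by (intro sum.cong) auto
    then show ?thesis using c[OF that] insert.hyps by simp
  qed
  then show ?case by blast
qed

lemma direct_sum_commute:
  assumes "direct_sum V A B"
  shows "direct_sum V B A"
proof -
  have "{a + b |a b. a \<in> A \<and> b \<in> B} = {b + a |b a. b \<in> B \<and> a \<in> A}"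
    by (rule Collect_cong) (metis add.commute)
  with assms show ?thesis by (simp add: direct_sum_def Int_commute)
qed

locale form_space =
  fixes V :: "'v::real_vector set" and b :: "'v \<Rightarrow> 'v \<Rightarrow> real"
  assumes subspace: "subspace V" and form: "symmetric_form_on V b"
begin

lemma linear: "u \<in> V \<Longrightarrow> linear_map_on V UNIV (b u)"
  using form by (auto simp: symmetric_form_on_def)

lemma sym: "u \<in> V \<Longrightarrow> v \<in> V \<Longrightarrow> b u v = b v u"
  using form by (auto simp: symmetric_form_on_def)

lemmas closed = subspace_0[OF subspace] subspace_add[OF subspace] subspace_diff[OF subspace]
  subspace_neg[OF subspace] subspace_scale[OF subspace]

lemma zero_right: "u \<in> V \<Longrightarrow> b u 0 = 0"
  and add_right: "u \<in> V \<Longrightarrow> v \<in> V \<Longrightarrow> w \<in> V \<Longrightarrow> b u (v + w) = b u v + b u w"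
  and diff_right: "u \<in> V \<Longrightarrow> v \<in> V \<Longrightarrow> w \<in> V \<Longrightarrow> b u (v - w) = b u v - b u w"
  and minus_right: "u \<in> V \<Longrightarrow> v \<in> V \<Longrightarrow> b u (- v) = - b u v"
  and scale_right: "u \<in> V \<Longrightarrow> v \<in> V \<Longrightarrow> b u (a *\<^sub>R v) = a * b u v"
  using linear_map_on_zero[OF linear subspace] linear_map_on_add[OF linear] linear_map_on_scale[OF linear]
    linear_map_on_diff[OF linear subspace] linear_map_on_minus[OF linear] by auto

lemma zero_left: "u \<in> V \<Longrightarrow> b 0 u = 0"
  and add_left: "u \<in> V \<Longrightarrow> v \<in> V \<Longrightarrow> w \<in> V \<Longrightarrow> b (v + w) u = b v u + b w u"
  and diff_left: "u \<in> V \<Longrightarrow> v \<in> V \<Longrightarrow> w \<in> V \<Longrightarrow> b (v - w) u = b v u - b w u"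
  and minus_left: "u \<in> V \<Longrightarrow> v \<in> V \<Longrightarrow> b (- v) u = - b v u"
  and scale_left: "u \<in> V \<Longrightarrow> v \<in> V \<Longrightarrow> b (a *\<^sub>R v) u = a * b v u"
  by (simp_all add: sym[of _ u] zero_right add_right diff_right minus_right scale_right closed)

lemmas simps = zero_left add_left diff_left minus_left scale_left
  zero_right add_right diff_right minus_right scale_right

lemma sum_right:
  "u \<in> V \<Longrightarrow> (\<And>i. i \<in> I \<Longrightarrow> s i \<in> V) \<Longrightarrow> b u (\<Sum>i\<in>I. c i *\<^sub>R s i) = (\<Sum>i\<in>I. c i * b u (s i))"
  using linear_map_on_sum[OF linear subspace, of u I s c] by simp

lemma sum_left:
  "u \<in> V \<Longrightarrow> (\<And>i. i \<in> I \<Longrightarrow> s i \<in> V) \<Longrightarrow> b (\<Sum>i\<in>I. c i *\<^sub>R s i) u = (\<Sum>i\<in>I. c i * b (s i) u)"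
proof -
  assume u: "u \<in> V" and s: "\<And>i. i \<in> I \<Longrightarrow> s i \<in> V"
  have "(\<Sum>i\<in>I. c i *\<^sub>R s i) \<in> V" using s subspace by (auto intro: subspace_sum subspace_scale)
  with u s show ?thesis using sum_right[of u I s c] by (simp add: sym[of _ u] cong: sum.cong)
qed

lemma subspace_orth: "A \<subseteq> V \<Longrightarrow> subspace (orth b V A)"
  by (rule subspaceI) (auto simp: orth_def simps closed subset_iff)

text \<open>
  The functional \<open>b v\<close> on \<open>A\<close> is represented by a vector of \<open>A\<close>: by nondegeneracy the generators of
  \<open>A\<close> define functionals with trivial common kernel, so \<open>b v\<close> is a combination of them. Hence a
  nondegenerate finitely generated subspace splits off orthogonally, whatever the signature.
\<close>

lemma orthogonal_projection:
  assumes "A \<subseteq> V" "finite B" "A = span B" "nondegenerate_on A b" "v \<in> V"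
  shows "\<exists>a\<in>A. \<forall>w\<in>A. b (v - a) w = 0"
proof -
  have A: "subspace A" and B: "B \<subseteq> A" using assms(3) by (auto intro: span_base)
  have lin: "linear_map_on A UNIV (b u)" if "u \<in> V" for u
    using linear[OF that] assms(1) by (simp add: linear_map_on_def subset_iff)
  have "\<exists>c. \<forall>w\<in>A. b v w = (\<Sum>u\<in>B. c u * b u w)"
  proof (rule functional_combination[OF A assms(2) lin lin[OF assms(5)]])
    fix w assume w: "w \<in> A" "\<And>u. u \<in> B \<Longrightarrow> b u w = 0"
    have "B \<subseteq> orth b V {w}" using w B assms(1) by (auto simp: orth_def)
    then have "A \<subseteq> orth b V {w}"
      unfolding assms(3) using w(1) assms(1) by (intro span_minimal subspace_orth) auto
    then have "b w u = 0" if "u \<in> A" for u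
      using that sym[of w u] w(1) assms(1) by (auto simp: orth_def subset_iff)
    with assms(4) w(1) have "w = 0" by (simp add: nondegenerate_on_def)
    then show "b v w = 0" using assms(5) zero_right by simp
  qed (use B assms(1) in auto)
  then obtain c where c: "b v w = (\<Sum>u\<in>B. c u * b u w)" if "w \<in> A" for w by auto
  have "(\<Sum>u\<in>B. c u *\<^sub>R u) \<in> A" using A B by (auto intro: subspace_sum subspace_scale)
  moreover have "b (v - (\<Sum>u\<in>B. c u *\<^sub>R u)) w = 0" if "w \<in> A" for w
    using that B assms(1,5) c[OF that] sum_left[of w B "\<lambda>u. u" c] calculation
    by (subst diff_left) (auto simp: subset_iff)
  ultimately show ?thesis by blast
qed

end

section \<open>Vector spaces with a complex structure and a Norden form\<close>

text \<open>
  The setting of one tangent space of the ambient manifold. The endomorphism \<open>J\<close> is self-adjoint for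
  \<open>g\<close>, so \<open>h u v = g (J u) v\<close> is again a symmetric form, and the \<open>h\<close>-orthogonal space of a subspace is the
  image under \<open>J\<close> of its \<open>g\<close>-orthogonal space.
\<close>

locale norden_space = form_space V g
  for V :: "'v::real_vector set" and g :: "'v \<Rightarrow> 'v \<Rightarrow> real" +
  fixes J :: "'v \<Rightarrow> 'v"
  assumes J: "linear_map_on V V J" and J2: "v \<in> V \<Longrightarrow> J (J v) = - v"
    and nondegenerate: "nondegenerate_on V g"
    and norden: "u \<in> V \<Longrightarrow> v \<in> V \<Longrightarrow> g (J u) (J v) = - g u v"
begin

abbreviation h :: "'v \<Rightarrow> 'v \<Rightarrow> real" where "h u v \<equiv> g (J u) v"

lemmas J_in = linear_map_on_in[OF J] and J_zero = linear_map_on_zero[OF J subspace]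
  and J_add = linear_map_on_add[OF J]
  and J_minus = linear_map_on_minus[OF J]

lemma J_adjoint: "u \<in> V \<Longrightarrow> v \<in> V \<Longrightarrow> g (J u) v = g u (J v)"
  using norden[of u "J v"] by (simp add: J2 J_in simps)

lemma J_inj: "inj_on J V"
proof (rule inj_onI)
  fix u v assume uv: "u \<in> V" "v \<in> V" "J u = J v"
  have "- u = J (J u)" using J2[OF uv(1)] by simp
  also have "\<dots> = - v" using J2[OF uv(2)] uv(3) by simp
  finally show "u = v" by simp
qed

lemma associated_form_space: "form_space V h"
proof
  show "symmetric_form_on V h"
    using sym J_in J_adjoint linear by (auto simp: symmetric_form_on_def)
qed (fact subspace)

text \<open>
  Here \<open>T\<close> is the tangent space of the submanifold, \<open>D\<close> its invariant part and \<open>P\<close> its totally real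
  part. The space decomposes \<open>g\<close>-orthogonally into \<open>D\<close>, \<open>P\<close>, \<open>J P\<close> and the rest \<open>K\<close>, all of them
  \<open>g\<close>-nondegenerate, where \<open>D\<close>, \<open>P + J P\<close> and \<open>K\<close> are invariant under \<open>J\<close>. Passing from \<open>g\<close> to \<open>h\<close>
  leaves the invariant parts nondegenerate and mutually orthogonal, but makes \<open>P\<close> and \<open>J P\<close> totally null
  and paired with each other. So \<open>P\<close> is the radical, \<open>D\<close> a screen, \<open>K\<close> a screen transversal space and
  \<open>J P\<close> a lightlike transversal space. The last claim says that the sum \<open>D + P + J P\<close> is direct.
\<close>

lemma CR_imp_radical:
  assumes P: "P \<subseteq> V" "finite B" "P = span B" and D: "D \<subseteq> V" "finite C" "D = span C"
    and T: "direct_sum T D P" "nondegenerate_on T g"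
    and orthogonal: "\<forall>u\<in>D. \<forall>v\<in>P. g u v = 0"
    and JD: "J ` D = D" and JP: "J ` P \<subseteq> orth g V T"
  defines "K \<equiv> orth g V (D \<union> P \<union> J ` P)"
  shows "T \<inter> orth h V T = P" "nondegenerate_on D h"
    "direct_sum (orth h V T) P K" "nondegenerate_on K h"
    "direct_sum (orth h V {u + v |u v. u \<in> D \<and> v \<in> K}) P (J ` P)"
    "\<forall>u\<in>J ` P. \<forall>v\<in>J ` P. h u v = 0"
    "\<And>d p p'. d \<in> D \<Longrightarrow> p \<in> P \<Longrightarrow> p' \<in> P \<Longrightarrow> d + p + J p' = 0 \<Longrightarrow> d = 0 \<and> p = 0 \<and> p' = 0"
proof -
  have DP: "g u v = 0" if "u \<in> D" "v \<in> P" for u v using orthogonal that by blast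
  have sP: "subspace P" and sD: "subspace D" using P(3) D(3) by auto
  note PV = subsetD[OF P(1)] and DV = subsetD[OF D(1)]
  have 0: "0 \<in> P" "0 \<in> D" using sP sD subspace_0 by auto
  have T_eq: "T = {d + p |d p. d \<in> D \<and> p \<in> P}" and DP0: "D \<inter> P = {0}"
    using T(1) by (auto simp: direct_sum_def)
  have "d + 0 \<in> T" if "d \<in> D" for d unfolding T_eq using that 0 by blast
  then have DT: "D \<subseteq> T" by auto
  have "0 + p \<in> T" if "p \<in> P" for p unfolding T_eq using that 0 by blast
  then have PT: "P \<subseteq> T" by auto
  have TV: "T \<subseteq> V" using closed PV DV unfolding T_eq by auto
  note PT' = subsetD[OF PT] and DT' = subsetD[OF DT] and TV' = subsetD[OF TV]
  have JD_in: "J d \<in> D" if "d \<in> D" for d using JD that by blast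
  have JP_T: "g (J p) t = 0" if "p \<in> P" "t \<in> T" for p t using JP that by (auto simp: orth_def)
  have T0: "t = 0" if t: "t \<in> T" "\<And>d. d \<in> D \<Longrightarrow> g t d = 0" "\<And>p. p \<in> P \<Longrightarrow> g t p = 0" for t
  proof -
    have "g t w = 0" if "w \<in> T" for w
    proof -
      from that obtain d p where "w = d + p" "d \<in> D" "p \<in> P" unfolding T_eq by auto
      then show ?thesis using t TV' DV PV by (simp add: add_right)
    qed
    with T(2) t(1) show ?thesis by (simp add: nondegenerate_on_def)
  qed
  have PD: "g p d = 0" if "p \<in> P" "d \<in> D" for p d
    using DP[OF that(2,1)] sym[OF PV[OF that(1)] DV[OF that(2)]] by simp
  have D0: "d = 0" if "d \<in> D" "\<And>d'. d' \<in> D \<Longrightarrow> g d d' = 0" for d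
    using T0[of d] that DP DT' by auto
  have P0: "p = 0" if "p \<in> P" "\<And>p'. p' \<in> P \<Longrightarrow> g p p' = 0" for p
    using T0[of p] that PD PT' by auto
  have J0: "v = 0" if "v \<in> V" "J v = 0" for v
    using J2[OF that(1)] that(2) J_zero by simp
  have K: "k \<in> V" "\<And>d. d \<in> D \<Longrightarrow> g k d = 0" "\<And>p. p \<in> P \<Longrightarrow> g k p = 0"
      "\<And>p. p \<in> P \<Longrightarrow> g k (J p) = 0" if "k \<in> K" for k
    using that by (auto simp: K_def orth_def)
  have KI: "k \<in> K" if "k \<in> V" "\<And>d. d \<in> D \<Longrightarrow> g k d = 0" "\<And>p. p \<in> P \<Longrightarrow> g k p = 0"
      "\<And>p. p \<in> P \<Longrightarrow> g k (J p) = 0" for k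
    using that by (auto simp: K_def orth_def)
  have sK: "subspace K"
    unfolding K_def using PV DV J_in by (intro subspace_orth) auto
  have JK: "J k \<in> K" if "k \<in> K" for k
  proof -
    note k = K[OF that]
    have "g (J k) (J p) = 0" if "p \<in> P" for p using norden[OF k(1) PV[OF that]] k(3)[OF that] by simp
    then show ?thesis
      using k JD_in by (intro KI) (simp_all add: J_in J_adjoint DV PV)
  qed
  have TI: "T \<inter> orth h V T \<subseteq> P"
  proof
    fix t assume t: "t \<in> T \<inter> orth h V T"
    then obtain d p where dp: "t = d + p" "d \<in> D" "p \<in> P" unfolding T_eq by auto
    have "g (J d) d' = 0" if "d' \<in> D" for d'
    proof -
      have "g (J t) d' = 0" using t that DT' by (auto simp: orth_def)
      then show ?thesis
        using dp JP_T[OF dp(3) DT'[OF that]] that DV PV by (simp add: J_add J_in simps)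
    qed
    then have "J d = 0" using D0[OF JD_in[OF dp(2)]] by auto
    then have "d = 0" using J0 DV dp by auto
    with dp show "t \<in> P" by auto
  qed
  have PN: "P \<subseteq> orth h V T" using JP_T PV by (auto simp: orth_def)
  show "T \<inter> orth h V T = P" using TI PN PT by auto
  show "nondegenerate_on D h"
    unfolding nondegenerate_on_def
  proof (intro ballI impI)
    fix u assume "u \<in> D" "\<forall>v\<in>D. g (J u) v = 0"
    then have "J u = 0" using D0[OF JD_in] by auto
    with \<open>u \<in> D\<close> show "u = 0" using J0 DV by auto
  qed
  have nP: "nondegenerate_on P g" using P0 by (auto simp: nondegenerate_on_def)
  have nD: "nondegenerate_on D g" using D0 by (auto simp: nondegenerate_on_def)
  have projP: "\<exists>p\<in>P. \<forall>w\<in>P. g (v - p) w = 0" if "v \<in> V" for v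
    using orthogonal_projection[OF P nP that] .
  have projD: "\<exists>p\<in>D. \<forall>w\<in>D. g (v - p) w = 0" if "v \<in> V" for v
    using orthogonal_projection[OF D nD that] .
  show "direct_sum (orth h V T) P K"
    unfolding direct_sum_def
  proof (intro conjI equalityI subsetI)
    fix v assume v: "v \<in> orth h V T"
    then have vV: "v \<in> V" and vT: "\<And>t. t \<in> T \<Longrightarrow> g (J v) t = 0" by (auto simp: orth_def)
    obtain p where p: "p \<in> P" "\<And>w. w \<in> P \<Longrightarrow> g (v - p) w = 0" using projP[OF vV] by auto
    have "v - p \<in> K"
    proof (rule KI)
      fix d assume d: "d \<in> D"
      then obtain d' where d': "d = J d'" "d' \<in> D" using JD by auto
      have "g v d = 0" using vT[OF DT'[OF d'(2)]] J_adjoint[OF vV DV[OF d'(2)]] d' by simp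
      then show "g (v - p) d = 0" using p(1) d PD vV PV DV by (simp add: simps)
    next
      fix q assume q: "q \<in> P"
      have "g v (J q) = 0" "g p (J q) = 0"
        using vT[OF PT'[OF q]] J_adjoint[OF vV PV[OF q]] JP_T[OF p(1) PT'[OF q]]
          J_adjoint[OF PV[OF p(1)] PV[OF q]] by auto
      then show "g (v - p) (J q) = 0" using vV PV p(1) q J_in by (simp add: simps)
    qed (use p vV PV closed in auto)
    moreover have "v = p + (v - p)" by simp
    ultimately show "v \<in> {a + b |a b. a \<in> P \<and> b \<in> K}" using p(1) by blast
  next
    fix v assume "v \<in> {a + b |a b. a \<in> P \<and> b \<in> K}"
    then obtain p k where pk: "v = p + k" "p \<in> P" "k \<in> K" by auto
    have "k \<in> orth h V T"
      using JK[OF pk(3)] K(1)[OF pk(3)]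
      by (auto simp: orth_def T_eq add_right K PV DV)
    moreover have "p \<in> orth h V T" using PN pk by auto
    ultimately show "v \<in> orth h V T"
      using pk(1) TV subspace_add form_space.subspace_orth[OF associated_form_space TV] by blast
  next
    fix x assume x: "x \<in> P \<inter> K"
    then show "x \<in> {0}" using P0[of x] K by auto
  qed (use 0 sK subspace_0 in auto)
  have decomp: "\<exists>d p p' k. v = d + p + J p' + k \<and> d \<in> D \<and> p \<in> P \<and> p' \<in> P \<and> k \<in> K" if v: "v \<in> V" for v
  proof -
    obtain d where d: "d \<in> D" "\<And>w. w \<in> D \<Longrightarrow> g (v - d) w = 0" using projD[OF v] by auto
    obtain p where p: "p \<in> P" "\<And>w. w \<in> P \<Longrightarrow> g (v - p) w = 0" using projP[OF v] by auto
    (* the component of v in J P is - J q, where q is the component of J v in P *)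
    obtain q where q: "q \<in> P" "\<And>w. w \<in> P \<Longrightarrow> g (J v - q) w = 0" using projP[OF J_in[OF v]] by auto
    note V = v DV[OF d(1)] PV[OF p(1)] PV[OF q(1)]
    let ?k = "v - d - p + J q"
    have "?k \<in> K"
    proof (rule KI)
      show "g ?k e = 0" if "e \<in> D" for e
        using d(2)[OF that] PD[OF p(1) that] JP_T[OF q(1) DT'[OF that]] V DV[OF that]
        by (simp add: simps closed J_in)
      show "g ?k e = 0" if "e \<in> P" for e
        using p(2)[OF that] DP[OF d(1) that] JP_T[OF q(1) PT'[OF that]] V PV[OF that]
        by (simp add: simps closed J_in)
      show "g ?k (J e) = 0" if "e \<in> P" for e
        using q(2)[OF that] V PV[OF that] JP_T[OF that DT'[OF d(1)]] JP_T[OF that PT'[OF p(1)]]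
          norden[OF V(4) PV[OF that]] J_adjoint[OF v PV[OF that]]
          sym[OF J_in[OF PV[OF that]]]
        by (simp add: simps closed J_in)
    qed (use V in \<open>simp add: closed J_in\<close>)
    moreover have "v = d + p + J (- q) + ?k" using V by (simp add: J_minus)
    moreover have "- q \<in> P" using q(1) sP subspace_neg by auto
    ultimately show ?thesis using d(1) p(1) by blast
  qed
  have orthV: "u = 0" if "u \<in> V" "\<And>v. v \<in> V \<Longrightarrow> g u v = 0" for u
    using nondegenerate that by (auto simp: nondegenerate_on_def)
  have K0: "k = 0" if k: "k \<in> K" "\<And>l. l \<in> K \<Longrightarrow> g k l = 0" for k
  proof (rule orthV)
    fix v assume "v \<in> V"
    then obtain d p p' l where v: "v = d + p + J p' + l" "d \<in> D" "p \<in> P" "p' \<in> P" "l \<in> K"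
      using decomp by blast
    then show "g k v = 0" using k(2)[of l] K[OF k(1)] K(1)[OF v(5)] DV PV J_in by (simp add: simps closed)
  qed (use k K in auto)
  have hK0: "k = 0" if k: "k \<in> K" "\<And>l. l \<in> K \<Longrightarrow> g (J k) l = 0" for k
    using J0[OF K(1)[OF k(1)]] K0[OF JK[OF k(1)]] k(2) by auto
  then show "nondegenerate_on K h" by (auto simp: nondegenerate_on_def)
  have hJP: "g (J (J p)) (J q) = 0" if "p \<in> P" "q \<in> P" for p q
    using that JP_T[OF that(2) PT'[OF that(1)]] sym[of p "J q"] PV J_in by (simp add: J2 simps)
  then show "\<forall>u\<in>J ` P. \<forall>v\<in>J ` P. h u v = 0" by auto
  show "direct_sum (orth h V {u + v |u v. u \<in> D \<and> v \<in> K}) P (J ` P)"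
    unfolding direct_sum_def
  proof (intro conjI equalityI subsetI)
    fix v assume v: "v \<in> orth h V {u + v |u v. u \<in> D \<and> v \<in> K}"
    have vV: "v \<in> V" and vD: "\<And>e. e \<in> D \<Longrightarrow> g (J v) e = 0" and vK: "\<And>k. k \<in> K \<Longrightarrow> g (J v) k = 0"
    proof -
      have *: "g (J v) (e + k) = 0" if "e \<in> D" "k \<in> K" for e k
        using v that by (auto simp: orth_def)
      show "v \<in> V" using v by (simp add: orth_def)
      show "g (J v) e = 0" if "e \<in> D" for e using *[OF that subspace_0[OF sK]] by simp
      show "g (J v) k = 0" if "k \<in> K" for k using *[OF 0(2) that] by simp
    qed
    obtain d p q k where dp: "v = d + p + J q + k" "d \<in> D" "p \<in> P" "q \<in> P" "k \<in> K"
      using decomp[OF vV] by blast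
    note V = DV[OF dp(2)] PV[OF dp(3)] PV[OF dp(4)] K(1)[OF dp(5)]
    have Jv: "J v = J d + J p - q + J k" using V dp(1) by (simp add: J_add J2 J_in closed)
    have "g (J d) e = 0" if "e \<in> D" for e
      using vD[OF that] JP_T[OF dp(3) DT'[OF that]] PD[OF dp(4) that] K(2)[OF JK[OF dp(5)] that] V DV[OF that]
      by (simp add: Jv simps closed J_in)
    then have "J d = 0" using D0[OF JD_in[OF dp(2)]] by auto
    then have d: "d = 0" using J0 V(1) by auto
    have "g (J k) l = 0" if "l \<in> K" for l
      using vK[OF that] K(3)[OF that dp(4)] K(4)[OF that dp(3)] V K(1)[OF that]
        sym[OF K(1)[OF that] V(3)] sym[OF K(1)[OF that] J_in[OF V(2)]]
      by (simp add: Jv d simps closed J_in J_zero)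
    then have "k = 0" using hK0 dp by auto
    then show "v \<in> {a + b |a b. a \<in> P \<and> b \<in> J ` P}" using dp d by auto
  next
    fix v assume "v \<in> {a + b |a b. a \<in> P \<and> b \<in> J ` P}"
    then obtain p q where v: "v = p + J q" "p \<in> P" "q \<in> P" by auto
    have "g (J v) (d + k) = 0" if "d \<in> D" "k \<in> K" for d k
      using v that PV K(1)[OF that(2)] JP_T[OF v(2) DT'[OF that(1)]] PD[OF v(3) that(1)] DV
        K(3)[OF that(2) v(3)] K(4)[OF that(2) v(2)]
        sym[OF PV[OF v(3)] K(1)[OF that(2)]] sym[OF J_in[OF PV[OF v(2)]] K(1)[OF that(2)]]
      by (simp add: J_add J_in simps closed J2)
    then show "v \<in> orth h V {u + v |u v. u \<in> D \<and> v \<in> K}"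
      using v PV by (auto simp: orth_def closed J_in)
  next
    fix x assume "x \<in> P \<inter> J ` P"
    then obtain q where "x \<in> P" "x = J q" "q \<in> P" by auto
    then show "x \<in> {0}" using P0[of x] JP_T PT' by auto
  next
    fix x :: 'v assume "x \<in> {0}"
    then show "x \<in> P \<inter> J ` P" using 0(1) J_zero by (metis IntI image_eqI singletonD)
  qed
  fix d p p' assume dpp: "d \<in> D" "p \<in> P" "p' \<in> P" "d + p + J p' = 0"
  note V = DV[OF dpp(1)] PV[OF dpp(2)] PV[OF dpp(3)]
  have *: "d + p = - J p'" using dpp(4) by (simp add: eq_neg_iff_add_eq_0)
  have "d + p = 0"
  proof (rule T0)
    show "d + p \<in> T" using dpp T_eq by auto
    show "g (d + p) e = 0" if "e \<in> D" for e
      unfolding * using JP_T[OF dpp(3) DT'[OF that]] DV[OF that] V by (simp add: simps J_in)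
    show "g (d + p) e = 0" if "e \<in> P" for e
      unfolding * using JP_T[OF dpp(3) PT'[OF that]] PV[OF that] V by (simp add: simps J_in)
  qed
  moreover from this have "p' = 0" using J0 V * by simp
  moreover have "d = 0"
  proof -
    have "d = - p" using \<open>d + p = 0\<close> by (simp add: eq_neg_iff_add_eq_0)
    then have "d \<in> D \<inter> P" using dpp sP subspace_neg by auto
    then show ?thesis using DP0 by auto
  qed
  ultimately show "d = 0 \<and> p = 0 \<and> p' = 0" by simp
qed

text \<open>
  Here \<open>R\<close> is the radical, \<open>S\<close> the screen, \<open>Z\<close> the screen transversal and \<open>L = J R\<close> the lightlike
  transversal space. The main claim is the nondegeneracy of \<open>g\<close> on \<open>T\<close>. A vector of \<open>T\<close> that is
  \<open>g\<close>-orthogonal to \<open>T\<close> has no component in \<open>S = J S\<close>, because \<open>h\<close> is nondegenerate there. If it is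
  \<open>r\<close> in \<open>R\<close>, then \<open>J r\<close> lies in \<open>L\<close> and is \<open>h\<close>-orthogonal to \<open>R\<close>, because \<open>h (J r) w = - g r w\<close>; it is
  \<open>h\<close>-orthogonal to the null space \<open>L\<close> and to \<open>S\<close> and \<open>Z\<close> anyway. As \<open>S + Z\<close> is
  nondegenerate for \<open>h\<close>, these four spaces span the whole space, so \<open>J r = 0\<close>.
\<close>

lemma radical_imp_CR:
  assumes T: "T \<subseteq> V" and S: "S \<subseteq> V" "finite B" "S = span B" and Z: "Z \<subseteq> V" "finite C" "Z = span C"
    and R: "R = T \<inter> orth h V T" and RS: "direct_sum T R S" "nondegenerate_on S h"
    and Z': "direct_sum (orth h V T) R Z" "nondegenerate_on Z h"
    and L: "direct_sum (orth h V {u + v |u v. u \<in> S \<and> v \<in> Z}) R L"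
    and LL: "\<forall>u\<in>L. \<forall>v\<in>L. h u v = 0"
    and JR: "J ` R = L" and JS: "J ` S = S"
  shows "nondegenerate_on T g" "direct_sum T S R" "\<forall>u\<in>S. \<forall>v\<in>R. g u v = 0" "J ` R \<subseteq> orth g V T"
proof -
  interpret h: form_space V h by (rule associated_form_space)
  have T_eq: "T = {r + s |r s. r \<in> R \<and> s \<in> S}" and RS0: "R \<inter> S = {0}"
    using RS(1) by (auto simp: direct_sum_def)
  show "direct_sum T S R" using RS(1) by (rule direct_sum_commute)
  have 0: "0 \<in> R" "0 \<in> S" "0 \<in> Z" using RS0 Z' by (auto simp: direct_sum_def)
  have "0 + s \<in> T" if "s \<in> S" for s unfolding T_eq using that 0 by blast
  then have ST: "S \<subseteq> T" by auto
  have RT: "R \<subseteq> T" using R by auto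
  have RV: "R \<subseteq> V" using RT T by auto
  have ZN: "Z \<subseteq> orth h V T"
  proof
    fix z assume "z \<in> Z"
    then have "0 + z \<in> orth h V T" using Z'(1) 0(1) unfolding direct_sum_def by blast
    then show "z \<in> orth h V T" by simp
  qed
  have Rh: "g (J r) t = 0" if "r \<in> R" "t \<in> T" for r t using that R by (auto simp: orth_def)
  note V = subsetD[OF T] subsetD[OF S(1)] subsetD[OF Z(1)] subsetD[OF RV]
  show SR: "\<forall>u\<in>S. \<forall>v\<in>R. g u v = 0"
  proof (intro ballI)
    fix u v assume uv: "u \<in> S" "v \<in> R"
    then obtain u' where "u = J u'" "u' \<in> S" using JS by auto
    then show "g u v = 0"
      using Rh[OF uv(2), of u'] ST J_adjoint[of u' v] sym[of u' "J v"] V uv J_in by auto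
  qed
  show "J ` R \<subseteq> orth g V T" using Rh V J_in by (auto simp: orth_def)
  show "nondegenerate_on T g"
    unfolding nondegenerate_on_def
  proof (intro ballI impI)
    fix t assume t: "t \<in> T" "\<forall>w\<in>T. g t w = 0"
    then obtain r s where rs: "t = r + s" "r \<in> R" "s \<in> S" unfolding T_eq by auto
    obtain s' where s': "s = J s'" "s' \<in> S" using JS rs by auto
    have "g (J s') w = 0" if "w \<in> S" for w
    proof -
      have "g t w = 0" using t that ST by auto
      moreover have "g r w = 0" using SR that rs sym[of w r] V by auto
      ultimately show ?thesis using rs s' that V by (simp add: simps)
    qed
    then have "s' = 0" using RS(2) s' by (auto simp: nondegenerate_on_def)
    then have "s = 0" using s' J_zero by simp
    then have r: "t = r" using rs by simp
    \<comment> \<open>It remains to show that \<open>J r\<close> is \<open>h\<close>-orthogonal to the whole space.\<close>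
    let ?E = "orth h V {u + v |u v. u \<in> S \<and> v \<in> Z}"
    have E_eq: "?E = {a + b |a b. a \<in> R \<and> b \<in> L}" using L by (simp add: direct_sum_def)
    have JrL: "J r \<in> L" using JR rs by auto
    have "0 + J r \<in> ?E" unfolding E_eq using JrL 0(1) by blast
    then have "J r \<in> ?E" by simp
    then have Jr: "g (J (J r)) (u + v) = 0" if "u \<in> S" "v \<in> Z" for u v
      using that by (auto simp: orth_def)
    have JrS: "g (J (J r)) w = 0" if "w \<in> S" for w using Jr[OF that 0(3)] by simp
    have JrZ: "g (J (J r)) w = 0" if "w \<in> Z" for w using Jr[OF 0(2) that] by simp
    have JrE: "g (J (J r)) w = 0" if "w \<in> ?E" for w
    proof -
      from that obtain a b where ab: "w = a + b" "a \<in> R" "b \<in> L" unfolding E_eq by auto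
      have "g (J (J r)) a = 0" using t(2) RT ab(2) r V rs by (simp add: J2 simps subset_iff)
      moreover have "g (J (J r)) b = 0" using LL JrL ab by auto
      moreover have "b \<in> V" using JR ab(3) J_in V by auto
      ultimately show ?thesis using ab V rs by (simp add: simps J_in)
    qed
    have "g (J (J r)) v = 0" if v: "v \<in> V" for v
    proof -
      obtain a where a: "a \<in> S" "\<And>w. w \<in> S \<Longrightarrow> g (J (v - a)) w = 0"
        using h.orthogonal_projection[OF S RS(2) v] by auto
      obtain c where c: "c \<in> Z" "\<And>w. w \<in> Z \<Longrightarrow> g (J (v - c)) w = 0"
        using h.orthogonal_projection[OF Z Z'(2) v] by auto
      have SZ: "g (J w) z = 0" "g (J z) w = 0" if "w \<in> S" "z \<in> Z" for w z
        using ZN ST that h.sym[of w z] V by (auto simp: orth_def subset_iff)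
      have w: "v - a - c \<in> ?E"
        using a c SZ v V by (auto simp: orth_def closed h.simps)
      have "v = a + c + (v - a - c)" by simp
      moreover have "g (J (J r)) (a + c + (v - a - c)) = 0"
        using JrS[OF a(1)] JrZ[OF c(1)] JrE[OF w] v V rs a(1) c(1)
        by (subst add_right, simp_all add: closed J_in, subst add_right, simp_all add: closed J_in)
      ultimately show ?thesis by simp
    qed
    then have "J (J r) = 0" using nondegenerate J_in V rs by (auto simp: nondegenerate_on_def)
    then show "t = 0" using r rs V by (simp add: J2)
  qed
qed

end

section \<open>Charts and tangent vectors\<close>

lemma sum_scaleR_apply: "(\<Sum>i\<in>I. a i *\<^sub>R s i) d = (\<Sum>i\<in>I. a i *\<^sub>R (s i d :: 'w::real_vector))"
  by (induction I rule: infinite_finite_induct) (auto simp: scaleR_fun_def)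

lemma smooth_manifold_inj:
  assumes "smooth_manifold P" "c \<in> atlas P"
  shows "inj_on (cmap c) (cdom c)"
proof -
  have "cdom c \<subseteq> points P" using assms openin_subset by (auto simp: smooth_manifold_def)
  then show ?thesis
    using assms homeomorphic_imp_injective_map[of "subtopology (topo P) (cdom c)"]
    by (force simp: smooth_manifold_def topspace_subtopology Int_absorb1)
qed

lemma cinv_cmap: "smooth_manifold P \<Longrightarrow> c \<in> atlas P \<Longrightarrow> x \<in> cdom c \<Longrightarrow> cinv c (cmap c x) = x"
  unfolding cinv_def using smooth_manifold_inj by (rule inv_into_f_f)

lemma open_coordinates:
  assumes "smooth_manifold P" "c \<in> atlas P" "openin (topo P) U"
  shows "open (cmap c ` (U \<inter> cdom c))"
proof -
  let ?X = "subtopology (topo P) (cdom c)" and ?Y = "top_of_set (cmap c ` cdom c)"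
  have "homeomorphic_map ?X ?Y (cmap c)" and o: "open (cmap c ` cdom c)"
    using assms(1,2) by (simp_all add: smooth_manifold_def)
  from homeomorphic_imp_open_map[OF this(1)] have "open_map ?X ?Y (cmap c)" .
  moreover have "openin ?X (U \<inter> cdom c)" using assms(3) by (auto simp: openin_subtopology)
  ultimately have "openin ?Y (cmap c ` (U \<inter> cdom c))" by (simp add: open_map_def)
  then show ?thesis using o openin_open_eq by blast
qed

text \<open>
  A submanifold without the immersion condition. The ambient manifold is included in itself in this
  sense, so that changes of charts within \<open>M\<close>, within \<open>N\<close>, and from \<open>M\<close> to \<open>N\<close> are covered by
  the same lemmas.
\<close>

definition smooth_inclusion ::
  "('a, 'f::euclidean_space) manifold \<Rightarrow> ('a, 'e::euclidean_space) manifold \<Rightarrow> bool" where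
  "smooth_inclusion P Q \<longleftrightarrow>
     smooth_manifold P \<and> smooth_manifold Q \<and> points P \<subseteq> points Q \<and> smooth_map P Q id"

lemma smooth_inclusion_refl: "smooth_manifold P \<Longrightarrow> smooth_inclusion P P"
proof -
  assume P: "smooth_manifold P"
  then have "smooth_on (cmap c ` (cdom c \<inter> id -` cdom d)) (cmap d \<circ> id \<circ> cinv c)"
    if "c \<in> atlas P" "d \<in> atlas P" for c d
    using that unfolding smooth_manifold_def by simp
  with P show ?thesis unfolding smooth_inclusion_def smooth_map_def by (intro conjI ballI continuous_map_id) auto
qed

lemma submanifold_inclusion: "submanifold P Q \<Longrightarrow> smooth_inclusion P Q"
  by (simp add: smooth_inclusion_def submanifold_def)

lemma openin_Int_ambient:
  assumes "smooth_inclusion P Q" "openin (topo P) U" "openin (topo Q) W"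
  shows "openin (topo P) (U \<inter> W)"
proof -
  have "openin (topo P) {x \<in> points P. id x \<in> W}"
    using assms(1,3) openin_continuous_map_preimage unfolding smooth_inclusion_def smooth_map_def by blast
  then have "openin (topo P) (U \<inter> {x \<in> points P. id x \<in> W})" using assms(2) by (rule openin_Int[rotated])
  moreover have "U \<inter> {x \<in> points P. id x \<in> W} = U \<inter> W" using openin_subset[OF assms(2)] by auto
  ultimately show ?thesis by simp
qed

lemma openin_cdom: "smooth_manifold Q \<Longrightarrow> d \<in> atlas Q \<Longrightarrow> openin (topo Q) (cdom d)"
  by (simp add: smooth_manifold_def)

lemma smooth_inclusionD:
  assumes "smooth_inclusion P Q"
  shows "smooth_manifold P" "smooth_manifold Q" "points P \<subseteq> points Q"
  using assms by (auto simp: smooth_inclusion_def)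

lemma open_section_domain:
  assumes "smooth_inclusion P Q" "openin (topo P) U" "c \<in> atlas P" "d \<in> atlas Q"
  shows "open (cmap c ` (U \<inter> cdom c \<inter> cdom d))"
proof -
  note PQ = smooth_inclusionD[OF assms(1)]
  have "openin (topo P) (U \<inter> cdom d)"
    using assms openin_cdom[OF PQ(2)] by (intro openin_Int_ambient[OF assms(1)])
  from open_coordinates[OF PQ(1) assms(3) this] show ?thesis by (simp add: Int_ac)
qed

lemma smooth_transition:
  assumes "smooth_inclusion P Q" "c \<in> atlas P" "d \<in> atlas Q"
  shows "smooth_on (cmap c ` (cdom c \<inter> cdom d)) (cmap d \<circ> cinv c)"
proof -
  have "smooth_on (cmap c ` (cdom c \<inter> id -` cdom d)) (cmap d \<circ> id \<circ> cinv c)"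
    using assms by (simp add: smooth_inclusion_def smooth_map_def del: id_apply)
  then show ?thesis by simp
qed

abbreviation transition_deriv ::
  "('a, 'f::euclidean_space) chart \<Rightarrow> ('a, 'e::euclidean_space) chart \<Rightarrow> 'a \<Rightarrow> 'f \<Rightarrow> 'e" where
  "transition_deriv c d x \<equiv> frechet_derivative (cmap d \<circ> cinv c) (at (cmap c x))"

lemma transition_differentiable:
  assumes "smooth_inclusion P Q" "c \<in> charts_at P x" "d \<in> charts_at Q x"
  shows "(cmap d \<circ> cinv c) differentiable (at (cmap c x))"
  using assms by (intro smooth_on_differentiable[OF smooth_transition[OF assms(1)]]) (auto simp: charts_at_def)

lemma transition_linear:
  assumes "smooth_inclusion P Q" "c \<in> charts_at P x" "d \<in> charts_at Q x"
  shows "linear (transition_deriv c d x)"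
  using transition_differentiable[OF assms] by (rule linear_frechet_derivative)

text \<open>
  The chain rule for coordinate changes across three manifolds. It gives at once the compatibility
  of tangent vectors with charts, the independence of the differential from the chart chosen in its
  definition, and the fact that the differential of the inclusion maps tangent vectors to tangent
  vectors.
\<close>

lemma transition_chain:
  assumes "smooth_inclusion P Q" "smooth_inclusion Q R"
    and "c \<in> charts_at P x" "d \<in> charts_at Q x" "e \<in> charts_at R x"
  shows "transition_deriv d e x (transition_deriv c d x v) = transition_deriv c e x v"
proof -
  note PQ = smooth_inclusionD[OF assms(1)]
  have c: "c \<in> atlas P" "x \<in> cdom c" and d: "d \<in> atlas Q" "x \<in> cdom d"
    and e: "e \<in> atlas R" "x \<in> cdom e"
    using assms by (auto simp: charts_at_def)
  have x: "(cmap d \<circ> cinv c) (cmap c x) = cmap d x" using c cinv_cmap[OF PQ(1)] by simp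
  have "((cmap e \<circ> cinv d) \<circ> (cmap d \<circ> cinv c) has_derivative
      transition_deriv d e x \<circ> transition_deriv c d x) (at (cmap c x))"
  proof (rule diff_chain_at)
    show "(cmap d \<circ> cinv c has_derivative transition_deriv c d x) (at (cmap c x))"
      using transition_differentiable[OF assms(1,3,4)] frechet_derivative_works by blast
    show "(cmap e \<circ> cinv d has_derivative transition_deriv d e x) (at ((cmap d \<circ> cinv c) (cmap c x)))"
      unfolding x using transition_differentiable[OF assms(2,4,5)] frechet_derivative_works by blast
  qed
  moreover have "open (cmap c ` (cdom c \<inter> (cdom d \<inter> cdom e)))"
  proof -
    have "openin (topo Q) (cdom d \<inter> cdom e)"
      using assms(2) openin_cdom[OF PQ(2) d(1)] openin_cdom[OF smooth_inclusionD(2)[OF assms(2)] e(1)]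
      by (rule openin_Int_ambient)
    with assms(1) openin_cdom[OF PQ(1) c(1)] have "openin (topo P) (cdom c \<inter> (cdom d \<inter> cdom e))"
      by (rule openin_Int_ambient)
    from open_coordinates[OF PQ(1) c(1) this] show ?thesis by (simp add: Int_ac)
  qed
  moreover have "cmap c x \<in> cmap c ` (cdom c \<inter> (cdom d \<inter> cdom e))" using c d e by auto
  moreover have "((cmap e \<circ> cinv d) \<circ> (cmap d \<circ> cinv c)) y = (cmap e \<circ> cinv c) y"
    if "y \<in> cmap c ` (cdom c \<inter> (cdom d \<inter> cdom e))" for y
    using that c d by (auto simp: cinv_cmap[OF PQ(1)] cinv_cmap[OF PQ(2)])
  ultimately have "(cmap e \<circ> cinv c has_derivative
      transition_deriv d e x \<circ> transition_deriv c d x) (at (cmap c x))"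
    by (rule has_derivative_transform_within_open)
  from frechet_derivative_at[OF this, THEN fun_cong, of v] show ?thesis by simp
qed

lemma transition_self:
  assumes "smooth_manifold P" "c \<in> charts_at P x"
  shows "transition_deriv c c x v = v"
proof -
  have c: "c \<in> atlas P" "x \<in> cdom c" using assms by (auto simp: charts_at_def)
  have "((cmap c \<circ> cinv c) has_derivative (\<lambda>v. v)) (at (cmap c x))"
  proof (rule has_derivative_transform_within_open[OF has_derivative_ident])
    show "open (cmap c ` cdom c)" using assms(1) c by (simp add: smooth_manifold_def)
    show "cmap c x \<in> cmap c ` cdom c" using c by auto
  qed (use c cinv_cmap[OF assms(1)] in auto)
  from frechet_derivative_at[OF this, THEN fun_cong, of v] show ?thesis by simp
qed

lemma charts_at_nonempty:
  assumes "smooth_manifold P" "x \<in> points P"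
  obtains c where "c \<in> charts_at P x"
proof -
  have "x \<in> (\<Union>c\<in>atlas P. cdom c)" using assms by (simp only: smooth_manifold_def)
  then show ?thesis using that by (auto simp: charts_at_def)
qed

lemma tangent_space_transition:
  "v \<in> tangent_space P x \<Longrightarrow> c \<in> charts_at P x \<Longrightarrow> d \<in> charts_at P x \<Longrightarrow> v d = transition_deriv c d x (v c)"
  unfolding tangent_space_def by blast

lemma tangent_space_outside: "v \<in> tangent_space P x \<Longrightarrow> c \<notin> charts_at P x \<Longrightarrow> v c = 0"
  by (simp add: tangent_space_def)

lemma tangent_spaceI:
  assumes "\<And>c. c \<notin> charts_at P x \<Longrightarrow> v c = 0"
    "\<And>c d. c \<in> charts_at P x \<Longrightarrow> d \<in> charts_at P x \<Longrightarrow> v d = transition_deriv c d x (v c)"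
  shows "v \<in> tangent_space P x"
  using assms unfolding tangent_space_def by blast

lemma tangent_space_eqI:
  assumes "u \<in> tangent_space P x" "v \<in> tangent_space P x" "c \<in> charts_at P x" "u c = v c"
  shows "u = v"
proof
  fix d show "u d = v d"
    using assms tangent_space_transition[of u P x c d] tangent_space_outside[of u P x d]
      tangent_space_transition[of v P x c d] tangent_space_outside[of v P x d]
    by (cases "d \<in> charts_at P x") simp_all
qed

lemma subspace_tangent_space:
  assumes "smooth_manifold P"
  shows "subspace (tangent_space P x)"
proof (rule subspaceI)
  note L = transition_linear[OF smooth_inclusion_refl[OF assms]]
  show "0 \<in> tangent_space P x"
    by (rule tangent_spaceI) (simp_all add: linear_0 L)
  show "u + v \<in> tangent_space P x" if u: "u \<in> tangent_space P x" and v: "v \<in> tangent_space P x" for u v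
  proof (rule tangent_spaceI)
    show "(u + v) c = 0" if "c \<notin> charts_at P x" for c
      using tangent_space_outside[OF u that] tangent_space_outside[OF v that] by simp
    show "(u + v) d = transition_deriv c d x ((u + v) c)"
      if "c \<in> charts_at P x" "d \<in> charts_at P x" for c d
      using tangent_space_transition[OF u that] tangent_space_transition[OF v that]
      by (simp add: linear_add[OF L[OF that]])
  qed
  show "a *\<^sub>R v \<in> tangent_space P x" if v: "v \<in> tangent_space P x" for a v
  proof (rule tangent_spaceI)
    show "(a *\<^sub>R v) c = 0" if "c \<notin> charts_at P x" for c
      using tangent_space_outside[OF v that] by (simp add: scaleR_fun_def)
    show "(a *\<^sub>R v) d = transition_deriv c d x ((a *\<^sub>R v) c)"
      if "c \<in> charts_at P x" "d \<in> charts_at P x" for c d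
      using tangent_space_transition[OF v that]
      by (simp add: scaleR_fun_def linear_scale[OF L[OF that]])
  qed
qed

lemma differential_eq:
  assumes "smooth_inclusion P Q" "v \<in> tangent_space P x" "c \<in> charts_at P x" "d \<in> charts_at Q x"
  shows "differential P Q id x v d = transition_deriv c d x (v c)"
proof -
  define c' where "c' = (SOME c. c \<in> charts_at P x)"
  have c': "c' \<in> charts_at P x" using assms(3) unfolding c'_def by (rule someI)
  have "differential P Q id x v d = transition_deriv c' d x (v c')"
    using assms(4) by (simp add: differential_def c'_def Let_def)
  also have "v c' = transition_deriv c c' x (v c)" using tangent_space_transition assms(2,3) c' .
  also have "transition_deriv c' d x \<dots> = transition_deriv c d x (v c)"
    using smooth_inclusion_refl[OF smooth_inclusionD(1)[OF assms(1)]] assms(1,3) c' assms(4)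
    by (rule transition_chain)
  finally show ?thesis .
qed

lemma linear_differential:
  assumes "smooth_inclusion P Q" "x \<in> points P"
  shows "linear_map_on (tangent_space P x) (tangent_space Q x) (differential P Q id x)"
proof -
  note PQ = smooth_inclusionD[OF assms(1)]
  obtain c where c: "c \<in> charts_at P x" using charts_at_nonempty PQ(1) assms(2) .
  note L = transition_linear[OF assms(1) c]
  have out: "differential P Q id x v d = 0" if "d \<notin> charts_at Q x" for v d
    using that by (simp add: differential_def)
  have eq: "differential P Q id x v d = (if d \<in> charts_at Q x then transition_deriv c d x (v c) else 0)"
    if "v \<in> tangent_space P x" for v d
    using differential_eq[OF assms(1) that c] out by simp
  have "differential P Q id x v \<in> tangent_space Q x" if v: "v \<in> tangent_space P x" for v
    using transition_chain[OF assms(1) smooth_inclusion_refl[OF PQ(2)] c]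
    by (intro tangent_spaceI) (simp_all add: eq v)
  moreover have "differential P Q id x (u + v) = differential P Q id x u + differential P Q id x v"
    if "u \<in> tangent_space P x" "v \<in> tangent_space P x" for u v
    using subspace_add[OF subspace_tangent_space[OF PQ(1)] that] that
    by (intro ext) (simp add: eq linear_add[OF L])
  moreover have "differential P Q id x (a *\<^sub>R v) = a *\<^sub>R differential P Q id x v"
    if "v \<in> tangent_space P x" for a v
    using subspace_scale[OF subspace_tangent_space[OF PQ(1)] that] that
    by (intro ext) (simp add: eq scaleR_fun_def linear_scale[OF L])
  ultimately show ?thesis by (simp add: linear_map_on_def)
qed

text \<open>
  The tangent vector with coordinates \<open>v\<close> in the chart \<open>d\<close>. As functions of the point, these vectors
  form the local frame that reduces smooth tensor fields to their components.
\<close>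

definition coord_vector ::
  "('a, 'e::euclidean_space) manifold \<Rightarrow> ('a, 'e) chart \<Rightarrow> 'e \<Rightarrow> 'a \<Rightarrow> ('a, 'e) tvec" where
  "coord_vector N d v x = (\<lambda>d'. if d' \<in> charts_at N x then transition_deriv d d' x v else 0)"

lemma coord_vector_tangent:
  assumes "smooth_manifold N" "d \<in> charts_at N x"
  shows "coord_vector N d v x \<in> tangent_space N x"
  using transition_chain[OF smooth_inclusion_refl[OF assms(1)] smooth_inclusion_refl[OF assms(1)] assms(2)]
  by (intro tangent_spaceI) (simp_all add: coord_vector_def)

lemma coord_vector_self:
  assumes "smooth_manifold N" "d \<in> charts_at N x"
  shows "coord_vector N d v x d = v"
  using transition_self[OF assms] assms(2) by (simp add: coord_vector_def)

lemma coord_vector_expand: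
  assumes "smooth_manifold N" "d \<in> charts_at N x" "v \<in> tangent_space N x"
  shows "v = (\<Sum>b\<in>Basis. (v d \<bullet> b) *\<^sub>R coord_vector N d b x)"
proof (rule tangent_space_eqI[OF assms(3) _ assms(2)])
  show "(\<Sum>b\<in>Basis. (v d \<bullet> b) *\<^sub>R coord_vector N d b x) \<in> tangent_space N x"
    using coord_vector_tangent[OF assms(1,2)] subspace_tangent_space[OF assms(1)]
    by (intro subspace_sum subspace_scale)
  show "v d = (\<Sum>b\<in>Basis. (v d \<bullet> b) *\<^sub>R coord_vector N d b x) d"
    by (simp add: sum_scaleR_apply coord_vector_self[OF assms(1,2)] euclidean_representation)
qed

lemma coord_vector_frame:
  assumes "smooth_manifold N" "d \<in> charts_at N x"
  shows "frame (Basis :: 'e::euclidean_space set) (\<lambda>b. coord_vector N d b x) (tangent_space N x)"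
proof (rule frameI)
  fix c :: "'e \<Rightarrow> real" and b :: 'e
  assume "(\<Sum>b\<in>Basis. c b *\<^sub>R coord_vector N d b x) = 0" and b: "b \<in> Basis"
  then have "(\<Sum>b\<in>Basis. c b *\<^sub>R coord_vector N d b x) d = 0" by simp
  then have "(\<Sum>b\<in>Basis. c b *\<^sub>R b) = 0"
    by (simp add: sum_scaleR_apply coord_vector_self[OF assms])
  then have "(\<Sum>b\<in>Basis. c b *\<^sub>R b) \<bullet> b = 0" by simp
  then show "c b = 0" using b by simp
next
  show "\<exists>c. v = (\<Sum>b\<in>Basis. c b *\<^sub>R coord_vector N d b x)" if "v \<in> tangent_space N x" for v
    using coord_vector_expand[OF assms that] by (rule exI[of _ "\<lambda>b. v d \<bullet> b"])
qed (simp_all add: coord_vector_tangent[OF assms] subspace_tangent_space[OF assms(1)])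

section \<open>Smooth sections along a submanifold\<close>

lemma smooth_section_tangent: "smooth_section M N U V \<Longrightarrow> x \<in> U \<Longrightarrow> V x \<in> tangent_space N x"
  by (simp add: smooth_section_def)

lemma smooth_section_component:
  "smooth_section M N U V \<Longrightarrow> c \<in> atlas M \<Longrightarrow> d \<in> atlas N \<Longrightarrow>
     smooth_on (cmap c ` (U \<inter> cdom c \<inter> cdom d)) (\<lambda>y. V (cinv c y) d)"
  by (simp add: smooth_section_def)

lemma smooth_sectionI:
  assumes "\<And>x. x \<in> U \<Longrightarrow> V x \<in> tangent_space N x"
    "\<And>c d. c \<in> atlas M \<Longrightarrow> d \<in> atlas N \<Longrightarrow>
       smooth_on (cmap c ` (U \<inter> cdom c \<inter> cdom d)) (\<lambda>y. V (cinv c y) d)"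
  shows "smooth_section M N U V"
  using assms by (simp add: smooth_section_def)

lemma smooth_section_subset: "smooth_section M N U V \<Longrightarrow> U' \<subseteq> U \<Longrightarrow> smooth_section M N U' V"
proof (rule smooth_sectionI)
  fix c d assume *: "smooth_section M N U V" "U' \<subseteq> U" and "c \<in> atlas M" "d \<in> atlas N"
  then have "smooth_on (cmap c ` (U \<inter> cdom c \<inter> cdom d)) (\<lambda>y. V (cinv c y) d)"
    by (intro smooth_section_component)
  then show "smooth_on (cmap c ` (U' \<inter> cdom c \<inter> cdom d)) (\<lambda>y. V (cinv c y) d)"
    by (rule smooth_on_subset) (use * in auto)
qed (auto simp: smooth_section_def)

lemma smooth_function_subset: "smooth_function M U f \<Longrightarrow> U' \<subseteq> U \<Longrightarrow> smooth_function M U' f"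
  unfolding smooth_function_def
proof
  fix c assume *: "\<forall>c\<in>atlas M. smooth_on (cmap c ` (U \<inter> cdom c)) (f \<circ> cinv c)" "U' \<subseteq> U" and "c \<in> atlas M"
  then have "smooth_on (cmap c ` (U \<inter> cdom c)) (f \<circ> cinv c)" by simp
  then show "smooth_on (cmap c ` (U' \<inter> cdom c)) (f \<circ> cinv c)"
    by (rule smooth_on_subset) (use * in auto)
qed

text \<open>
  Sections are described by pairs of charts, one of \<open>M\<close> and one of \<open>N\<close>, but smooth functions by charts of
  \<open>M\<close> alone. Functions computed from sections are known in the former way.
\<close>

lemma smooth_functionI:
  assumes MN: "smooth_inclusion M N" and U: "openin (topo M) U"
    and f: "\<And>c d. c \<in> atlas M \<Longrightarrow> d \<in> atlas N \<Longrightarrow>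
      smooth_on (cmap c ` (U \<inter> cdom c \<inter> cdom d)) (f \<circ> cinv c)"
  shows "smooth_function M U f"
  unfolding smooth_function_def
proof
  fix c assume c: "c \<in> atlas M"
  have "U \<subseteq> (\<Union>d\<in>atlas N. cdom d)"
    using openin_subset[OF U] smooth_inclusionD[OF MN] unfolding smooth_manifold_def by auto
  then have "cmap c ` (U \<inter> cdom c) = (\<Union>d\<in>atlas N. cmap c ` (U \<inter> cdom c \<inter> cdom d))" by blast
  moreover have "smooth_on (\<Union>d\<in>atlas N. cmap c ` (U \<inter> cdom c \<inter> cdom d)) (f \<circ> cinv c)"
    using open_section_domain[OF MN U c] f[OF c] by (intro smooth_on_Union) auto
  ultimately show "smooth_on (cmap c ` (U \<inter> cdom c)) (f \<circ> cinv c)" by simp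
qed

lemma open_nonzero:
  assumes M: "smooth_manifold M" and U: "openin (topo M) U" and f: "smooth_function M U f"
  shows "openin (topo M) {p \<in> U. f p \<noteq> 0}"
proof (subst openin_subopen, intro ballI)
  fix x assume x: "x \<in> {p \<in> U. f p \<noteq> 0}"
  then have "x \<in> points M" using openin_subset[OF U] by auto
  with M obtain c where "c \<in> charts_at M x" by (rule charts_at_nonempty)
  then have c: "c \<in> atlas M" "x \<in> cdom c" by (auto simp: charts_at_def)
  let ?S = "cmap c ` (U \<inter> cdom c)" and ?X = "subtopology (topo M) (cdom c)"
  have "open ?S" using open_coordinates[OF M c(1) U] .
  moreover have "continuous_on ?S (f \<circ> cinv c)"
    using f c by (intro smooth_on_continuous) (simp add: smooth_function_def)
  ultimately have "open (?S \<inter> (f \<circ> cinv c) -` (- {0}))"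
    by (intro continuous_open_preimage) auto
  moreover have "homeomorphic_map ?X (top_of_set (cmap c ` cdom c)) (cmap c)"
    using M c by (simp add: smooth_manifold_def)
  then have "continuous_map ?X euclidean (cmap c)"
    by (intro continuous_map_into_fulltopology[OF homeomorphic_imp_continuous_map])
  ultimately have "openin ?X {p \<in> topspace ?X. cmap c p \<in> ?S \<inter> (f \<circ> cinv c) -` (- {0})}"
    by (intro openin_continuous_map_preimage[of ?X euclidean]) simp_all
  then have "openin (topo M) {p \<in> topspace ?X. cmap c p \<in> ?S \<inter> (f \<circ> cinv c) -` (- {0})}" (is "openin _ ?W")
    using openin_cdom[OF M c(1)] by (rule openin_trans_full)
  moreover have "?W = {p \<in> U. f p \<noteq> 0} \<inter> cdom c"
  proof (intro equalityI subsetI)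
    fix p assume p: "p \<in> ?W"
    then have "p \<in> cdom c" by simp
    moreover from p obtain q where "q \<in> U" "q \<in> cdom c" "cmap c p = cmap c q" by auto
    ultimately have "p \<in> U" "p \<in> cdom c" using cinv_cmap[OF M c(1)] by metis+
    with p show "p \<in> {p \<in> U. f p \<noteq> 0} \<inter> cdom c" by (simp add: cinv_cmap[OF M c(1)])
  next
    fix p assume "p \<in> {p \<in> U. f p \<noteq> 0} \<inter> cdom c"
    then show "p \<in> ?W" using openin_subset[OF U] by (auto simp: cinv_cmap[OF M c(1)])
  qed
  ultimately show "\<exists>T. openin (topo M) T \<and> x \<in> T \<and> T \<subseteq> {p \<in> U. f p \<noteq> 0}" using x c by auto
qed

lemma smooth_section_add_scale:
  assumes MN: "smooth_inclusion M N" and U: "openin (topo M) U"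
    and V: "smooth_section M N U V" and W: "smooth_section M N U W" and f: "smooth_function M U f"
  shows "smooth_section M N U (\<lambda>x. V x + f x *\<^sub>R W x)"
proof (rule smooth_sectionI)
  note sub = subspace_tangent_space[OF smooth_inclusionD(2)[OF MN]]
  show "V x + f x *\<^sub>R W x \<in> tangent_space N x" if "x \<in> U" for x
    using smooth_section_tangent[OF V that] smooth_section_tangent[OF W that] sub
    by (intro subspace_add subspace_scale)
  fix c d assume cd: "c \<in> atlas M" "d \<in> atlas N"
  let ?S = "cmap c ` (U \<inter> cdom c \<inter> cdom d)"
  have "smooth_on (cmap c ` (U \<inter> cdom c)) (f \<circ> cinv c)" using f cd by (simp add: smooth_function_def)
  then have "smooth_on ?S (\<lambda>y. f (cinv c y))"
    using smooth_on_subset[of _ "f \<circ> cinv c" ?S] by (auto simp: o_def)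
  then have "smooth_on ?S (\<lambda>y. V (cinv c y) d + f (cinv c y) *\<^sub>R W (cinv c y) d)"
    using smooth_section_component[OF V cd] smooth_section_component[OF W cd]
    by (intro smooth_on_add smooth_on_scaleR open_section_domain[OF MN U cd])
  then show "smooth_on ?S (\<lambda>y. (V (cinv c y) + f (cinv c y) *\<^sub>R W (cinv c y)) d)"
    by (simp add: scaleR_fun_def)
qed

lemma smooth_function_divide:
  assumes M: "smooth_manifold M" and U: "openin (topo M) U"
    and f: "smooth_function M U f" and h: "smooth_function M U h" and "\<And>x. x \<in> U \<Longrightarrow> h x \<noteq> 0"
  shows "smooth_function M U (\<lambda>x. - (f x / h x))"
  unfolding smooth_function_def
proof
  fix c assume c: "c \<in> atlas M"
  let ?S = "cmap c ` (U \<inter> cdom c)"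
  have S: "open ?S" using open_coordinates[OF M c U] .
  have "h (cinv c y) \<noteq> 0" if "y \<in> ?S" for y
    using that assms(5) cinv_cmap[OF M c] by auto
  moreover have "smooth_on ?S (\<lambda>y. f (cinv c y))" "smooth_on ?S (\<lambda>y. h (cinv c y))"
    using f h c by (simp_all add: smooth_function_def o_def)
  ultimately have "smooth_on ?S (\<lambda>y. (-1) * (f (cinv c y) * inverse (h (cinv c y))))"
    by (intro smooth_on_mult S smooth_on_inverse smooth_on_const)
  then show "smooth_on ?S ((\<lambda>x. - (f x / h x)) \<circ> cinv c)"
    by (simp add: o_def divide_inverse)
qed

text \<open>
  The components of \<open>J\<close> and \<open>g\<close> are smooth functions \<open>F\<close> in a chart of \<open>N\<close>. They become smooth functions
  in a chart of \<open>M\<close> by composition with the coordinate form of the inclusion.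
\<close>

lemma smooth_along_ambient:
  assumes MN: "smooth_inclusion M N" and U: "openin (topo M) U"
    and c: "c \<in> atlas M" and d: "d \<in> atlas N" and W: "openin (topo N) W" "W \<subseteq> cdom d"
    and F: "smooth_on (cmap d ` W) F" and "U \<inter> cdom c \<inter> cdom d' \<subseteq> W" "d' \<in> atlas N"
  shows "smooth_on (cmap c ` (U \<inter> cdom c \<inter> cdom d')) (\<lambda>y. F (cmap d (cinv c y)))"
proof -
  note M = smooth_inclusionD[OF MN]
  let ?S = "cmap c ` (U \<inter> cdom c \<inter> cdom d')"
  have S: "open ?S" using open_section_domain[OF MN U c assms(9)] .
  moreover have "open (cmap d ` W)" using open_coordinates[OF M(2) d W(1)] W(2) by (simp add: Int_absorb2)
  moreover have "(cmap d \<circ> cinv c) ` ?S \<subseteq> cmap d ` W" using cinv_cmap[OF M(1) c] assms(8) by auto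
  moreover have "smooth_on ?S (cmap d \<circ> cinv c)"
    using smooth_transition[OF MN c d] by (rule smooth_on_subset) (use assms(8) W(2) in auto)
  ultimately have "smooth_on ?S (F \<circ> (cmap d \<circ> cinv c))" using F by (rule smooth_on_compose)
  then show ?thesis by (simp add: o_def)
qed

lemma smooth_section_coord_vector:
  assumes MN: "smooth_inclusion M N" and U: "openin (topo M) U" and d: "d \<in> atlas N" "U \<subseteq> cdom d"
  shows "smooth_section M N U (coord_vector N d v)"
proof (rule smooth_sectionI)
  note M = smooth_inclusionD[OF MN]
  show "coord_vector N d v x \<in> tangent_space N x" if "x \<in> U" for x
    using that d by (intro coord_vector_tangent[OF M(2)]) (auto simp: charts_at_def)
  fix c d' assume c: "c \<in> atlas M" and d': "d' \<in> atlas N"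
  let ?S = "cmap c ` (U \<inter> cdom c \<inter> cdom d')"
  note N = smooth_inclusion_refl[OF M(2)]
  have "smooth_on ?S (\<lambda>y. frechet_derivative (cmap d' \<circ> cinv d) (at (cmap d (cinv c y))) v)"
  proof (rule smooth_along_ambient[OF MN U c d(1), of "cdom d \<inter> cdom d'"])
    show "smooth_on (cmap d ` (cdom d \<inter> cdom d')) (\<lambda>z. frechet_derivative (cmap d' \<circ> cinv d) (at z) v)"
      using smooth_transition[OF N d(1) d'] by (rule smooth_on_derivative)
    show "openin (topo N) (cdom d \<inter> cdom d')"
      using openin_Int openin_cdom[OF M(2)] d(1) d' by blast
  qed (use d d' in auto)
  then show "smooth_on ?S (\<lambda>y. coord_vector N d v (cinv c y) d')"
  proof (rule smooth_on_cong[rotated 2, OF _ open_section_domain[OF MN U c d']])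
    fix y assume "y \<in> ?S"
    then have "d' \<in> charts_at N (cinv c y)"
      using cinv_cmap[OF M(1) c] d' by (auto simp: charts_at_def)
    then show "frechet_derivative (cmap d' \<circ> cinv d) (at (cmap d (cinv c y))) v =
        coord_vector N d v (cinv c y) d'"
      by (simp add: coord_vector_def)
  qed
qed

text \<open>
  The smoothness of \<open>J\<close> is given for vector fields on open subsets of \<open>N\<close>, whereas a section along \<open>M\<close>
  need not extend to \<open>N\<close>. Therefore \<open>J\<close> is applied to the coordinate fields on \<open>N\<close>, and the section is
  expanded in them; the same is done for \<open>g\<close> below.
\<close>

lemma smooth_section_J:
  assumes MN: "smooth_inclusion M N" and J: "almost_complex_structure N J"
    and U: "openin (topo M) U" and V: "smooth_section M N U V"
  shows "smooth_section M N U (\<lambda>x. J x (V x))"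
proof (rule smooth_sectionI)
  note M = smooth_inclusionD[OF MN]
  have UN: "x \<in> points N" if "x \<in> U" for x using openin_subset[OF U] M(3) that by auto
  have lin: "linear_map_on (tangent_space N x) (tangent_space N x) (J x)" if "x \<in> U" for x
    using J UN[OF that] by (simp add: almost_complex_structure_def)
  show "J x (V x) \<in> tangent_space N x" if "x \<in> U" for x
    using lin[OF that] smooth_section_tangent[OF V that] by (rule linear_map_on_in)
  fix c d assume c: "c \<in> atlas M" and d: "d \<in> atlas N"
  let ?S = "cmap c ` (U \<inter> cdom c \<inter> cdom d)"
  define F where "F b z = J (cinv d z) (coord_vector N d b (cinv d z)) d" for b z
  have S: "open ?S" using open_section_domain[OF MN U c d] .
  have "smooth_on (cmap d ` cdom d) (F b)" for b
  proof -
    have "smooth_section N N (cdom d) (coord_vector N d b)"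
      using smooth_inclusion_refl[OF M(2)] openin_cdom[OF M(2) d] d by (rule smooth_section_coord_vector) simp
    with J openin_cdom[OF M(2) d]
    have "smooth_section N N (cdom d) (\<lambda>x. J x (coord_vector N d b x))"
      unfolding almost_complex_structure_def by blast
    from smooth_section_component[OF this d d] show ?thesis by (simp add: F_def[abs_def])
  qed
  then have F: "smooth_on ?S (\<lambda>y. F b (cmap d (cinv c y)))" for b
    using openin_cdom[OF M(2) d] d by (intro smooth_along_ambient[OF MN U c d, of "cdom d"]) auto
  have "smooth_on ?S (\<lambda>y. \<Sum>b\<in>Basis. (V (cinv c y) d \<bullet> b) *\<^sub>R F b (cmap d (cinv c y)))"
    using smooth_section_component[OF V c d]
    by (intro smooth_on_sum smooth_on_scaleR smooth_on_inner smooth_on_const S F)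
  then show "smooth_on ?S (\<lambda>y. J (cinv c y) (V (cinv c y)) d)"
  proof (rule smooth_on_cong[rotated 2, OF _ S])
    fix y assume "y \<in> ?S"
    then obtain x where x: "x \<in> U" "x \<in> cdom d" "cinv c y = x"
      using cinv_cmap[OF M(1) c] by auto
    have dx: "d \<in> charts_at N x" using x d by (simp add: charts_at_def)
    have "J x (V x) = J x (\<Sum>b\<in>Basis. (V x d \<bullet> b) *\<^sub>R coord_vector N d b x)"
      using coord_vector_expand[OF M(2) dx smooth_section_tangent[OF V x(1)]] by simp
    also have "\<dots> = (\<Sum>b\<in>Basis. (V x d \<bullet> b) *\<^sub>R J x (coord_vector N d b x))"
      using lin[OF x(1)] subspace_tangent_space[OF M(2)] coord_vector_tangent[OF M(2) dx]
      by (rule linear_map_on_sum)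
    finally show "(\<Sum>b\<in>Basis. (V (cinv c y) d \<bullet> b) *\<^sub>R F b (cmap d (cinv c y))) = J (cinv c y) (V (cinv c y)) d"
      using x by (simp add: F_def sum_scaleR_apply cinv_cmap[OF M(2) d])
  qed
qed

lemma smooth_function_metric:
  assumes MN: "smooth_inclusion M N" and g: "semi_riemannian_metric N g"
    and U: "openin (topo M) U" and V: "smooth_section M N U V" and W: "smooth_section M N U W"
  shows "smooth_function M U (\<lambda>x. g x (V x) (W x))"
proof (rule smooth_functionI[OF MN U])
  note M = smooth_inclusionD[OF MN]
  have UN: "x \<in> points N" if "x \<in> U" for x using openin_subset[OF U] M(3) that by auto
  fix c d assume c: "c \<in> atlas M" and d: "d \<in> atlas N"
  let ?S = "cmap c ` (U \<inter> cdom c \<inter> cdom d)"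
  define F where
    "F a b z = g (cinv d z) (coord_vector N d a (cinv d z)) (coord_vector N d b (cinv d z))" for a b z
  have S: "open ?S" using open_section_domain[OF MN U c d] .
  have "smooth_on (cmap d ` cdom d) (F a b)" for a b
  proof -
    have "smooth_section N N (cdom d) (coord_vector N d b)" for b
      using smooth_inclusion_refl[OF M(2)] openin_cdom[OF M(2) d] d by (rule smooth_section_coord_vector) simp
    with g openin_cdom[OF M(2) d]
    have "smooth_function N (cdom d) (\<lambda>x. g x (coord_vector N d a x) (coord_vector N d b x))"
      unfolding semi_riemannian_metric_def by blast
    then have "smooth_on (cmap d ` (cdom d \<inter> cdom d))
        ((\<lambda>x. g x (coord_vector N d a x) (coord_vector N d b x)) \<circ> cinv d)"
      using d unfolding smooth_function_def by (rule bspec)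
    then show ?thesis by (simp add: F_def[abs_def] o_def)
  qed
  then have F: "smooth_on ?S (\<lambda>y. F a b (cmap d (cinv c y)))" for a b
    using openin_cdom[OF M(2) d] d by (intro smooth_along_ambient[OF MN U c d, of "cdom d"]) auto
  have "smooth_on ?S (\<lambda>y. \<Sum>a\<in>Basis. (V (cinv c y) d \<bullet> a) *
      (\<Sum>b\<in>Basis. (W (cinv c y) d \<bullet> b) * F a b (cmap d (cinv c y))))"
    using smooth_section_component[OF V c d] smooth_section_component[OF W c d]
    by (intro smooth_on_sum smooth_on_mult smooth_on_inner smooth_on_const S F)
  then show "smooth_on ?S ((\<lambda>x. g x (V x) (W x)) \<circ> cinv c)"
  proof (rule smooth_on_cong[rotated 2, OF _ S])
    fix y assume "y \<in> ?S"
    then obtain x where x: "x \<in> U" "x \<in> cdom d" "cinv c y = x"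
      using cinv_cmap[OF M(1) c] by auto
    have dx: "d \<in> charts_at N x" using x d by (simp add: charts_at_def)
    have "symmetric_form_on (tangent_space N x) (g x)"
      using g UN[OF x(1)] by (simp add: semi_riemannian_metric_def)
    with subspace_tangent_space[OF M(2)] interpret form_space "tangent_space N x" "g x"
      by (rule form_space.intro)
    note E = coord_vector_tangent[OF M(2) dx]
    note VW = smooth_section_tangent[OF V x(1)] smooth_section_tangent[OF W x(1)]
    have W': "g x (coord_vector N d a x) (W x) =
        (\<Sum>b\<in>Basis. (W x d \<bullet> b) * g x (coord_vector N d a x) (coord_vector N d b x))" for a
    proof -
      have "g x (coord_vector N d a x) (W x) =
          g x (coord_vector N d a x) (\<Sum>b\<in>Basis. (W x d \<bullet> b) *\<^sub>R coord_vector N d b x)"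
        using coord_vector_expand[OF M(2) dx VW(2)] by simp
      also have "\<dots> = (\<Sum>b\<in>Basis. (W x d \<bullet> b) * g x (coord_vector N d a x) (coord_vector N d b x))"
        using E E by (rule sum_right)
      finally show ?thesis .
    qed
    have "g x (V x) (W x) = g x (\<Sum>a\<in>Basis. (V x d \<bullet> a) *\<^sub>R coord_vector N d a x) (W x)"
      using coord_vector_expand[OF M(2) dx VW(1)] by simp
    also have "\<dots> = (\<Sum>a\<in>Basis. (V x d \<bullet> a) * g x (coord_vector N d a x) (W x))"
      using VW(2) E by (rule sum_left)
    finally show "(\<Sum>a\<in>Basis. (V (cinv c y) d \<bullet> a) *
        (\<Sum>b\<in>Basis. (W (cinv c y) d \<bullet> b) * F a b (cmap d (cinv c y)))) =
        ((\<lambda>x. g x (V x) (W x)) \<circ> cinv c) y"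
      using x by (simp add: F_def cinv_cmap[OF M(2) d] W')
  qed
qed

lemma smooth_section_differential:
  assumes MN: "smooth_inclusion M N" and U: "openin (topo M) U" and V: "smooth_section M M U V"
  shows "smooth_section M N U (\<lambda>x. differential M N id x (V x))"
proof (rule smooth_sectionI)
  note M = smooth_inclusionD[OF MN]
  show "differential M N id x (V x) \<in> tangent_space N x" if "x \<in> U" for x
    using openin_subset[OF U] that smooth_section_tangent[OF V that]
    by (intro linear_map_on_in[OF linear_differential[OF MN]]) auto
  fix c d assume c: "c \<in> atlas M" and d: "d \<in> atlas N"
  let ?S = "cmap c ` (U \<inter> cdom c \<inter> cdom d)"
  have S: "open ?S" using open_section_domain[OF MN U c d] .
  have "smooth_on ?S (\<lambda>y. frechet_derivative (cmap d \<circ> cinv c) (at y) (V (cinv c y) c))"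
  proof (rule smooth_on_apply_derivative[OF S])
    show "smooth_on ?S (cmap d \<circ> cinv c)"
      using smooth_transition[OF MN c d] by (rule smooth_on_subset) auto
    show "smooth_on ?S (\<lambda>y. V (cinv c y) c)"
      using smooth_section_component[OF V c c] by (rule smooth_on_subset) auto
  qed
  then show "smooth_on ?S (\<lambda>y. differential M N id (cinv c y) (V (cinv c y)) d)"
  proof (rule smooth_on_cong[rotated 2, OF _ S])
    fix y assume "y \<in> ?S"
    then obtain x where x: "x \<in> U" "x \<in> cdom c" "x \<in> cdom d" "y = cmap c x" by auto
    have "differential M N id x (V x) d = transition_deriv c d x (V x c)"
      using smooth_section_tangent[OF V x(1)] x c d
      by (intro differential_eq[OF MN]) (auto simp: charts_at_def)
    then show "frechet_derivative (cmap d \<circ> cinv c) (at y) (V (cinv c y) c) =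
        differential M N id (cinv c y) (V (cinv c y)) d"
      using x by (simp add: cinv_cmap[OF M(1) c])
  qed
qed

section \<open>Local frames of subbundles\<close>

lemma (in form_space) orth_span:
  assumes "B \<subseteq> V"
  shows "orth b V (span B) = orth b V B"
proof
  show "orth b V (span B) \<subseteq> orth b V B" by (auto simp: orth_def intro: span_base)
  show "orth b V B \<subseteq> orth b V (span B)"
  proof
    fix v assume v: "v \<in> orth b V B"
    then have vV: "v \<in> V" by (simp add: orth_def)
    have "B \<subseteq> orth b V {v}" using v assms sym[OF vV] by (auto simp: orth_def subset_iff)
    then have "span B \<subseteq> orth b V {v}" using vV by (intro span_minimal subspace_orth) auto
    then show "v \<in> orth b V (span B)" using vV sym[OF vV] by (auto simp: orth_def subset_iff)
  qed
qed

text \<open>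
  One step of Gaussian elimination with pivot \<open>s j\<close>. The new family is a basis of the kernel by pure
  algebra, and its coefficients involve no operation other than a division by \<open>\<phi> (s j)\<close>.
\<close>

lemma frame_kernel:
  assumes F: "frame I s E" and \<phi>: "linear_map_on E UNIV (\<phi> :: 'v::real_vector \<Rightarrow> real)"
    and j: "j \<in> I" "\<phi> (s j) \<noteq> 0"
  shows "frame (I - {j}) (\<lambda>i. s i + (- (\<phi> (s i) / \<phi> (s j))) *\<^sub>R s j) {v \<in> E. \<phi> v = 0}"
proof (rule frameI)
  let ?q = "\<lambda>i. - (\<phi> (s i) / \<phi> (s j))"
  note E = frame_subspace[OF F] and fin = frame_finite[OF F] and s = frame_in[OF F]
  have sum_eq: "(\<Sum>i\<in>I - {j}. c i *\<^sub>R (s i + ?q i *\<^sub>R s j)) =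
      (\<Sum>i\<in>I. (c(j := \<Sum>i\<in>I - {j}. c i * ?q i)) i *\<^sub>R s i)" for c
  proof -
    have "(\<Sum>i\<in>I - {j}. c i *\<^sub>R (s i + ?q i *\<^sub>R s j)) =
        (\<Sum>i\<in>I - {j}. c i *\<^sub>R s i) + (\<Sum>i\<in>I - {j}. c i * ?q i) *\<^sub>R s j"
      by (simp only: scaleR_add_right sum.distrib scaleR_scaleR scaleR_left.sum)
    also have "(\<Sum>i\<in>I - {j}. c i *\<^sub>R s i) =
        (\<Sum>i\<in>I - {j}. (c(j := \<Sum>i\<in>I - {j}. c i * ?q i)) i *\<^sub>R s i)"
      by (intro sum.cong) auto
    finally show ?thesis by (simp add: sum.remove[OF fin j(1)] add.commute)
  qed
  show "c i = 0" if c: "(\<Sum>i\<in>I - {j}. c i *\<^sub>R (s i + ?q i *\<^sub>R s j)) = 0" and i: "i \<in> I - {j}" for c i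
    using frame_zero[OF F c[unfolded sum_eq], of i] i by simp
  show "subspace {v \<in> E. \<phi> v = 0}"
    using E linear_map_on_zero[OF \<phi> E]
    by (intro subspaceI) (auto simp: subspace_0 subspace_add subspace_scale
        linear_map_on_add[OF \<phi>] linear_map_on_scale[OF \<phi>])
  show "s i + ?q i *\<^sub>R s j \<in> {v \<in> E. \<phi> v = 0}" if "i \<in> I - {j}" for i
  proof -
    have i: "s i \<in> E" using s that by simp
    have q: "?q i *\<^sub>R s j \<in> E" using E s[OF j(1)] by (rule subspace_scale)
    have "\<phi> (s i + ?q i *\<^sub>R s j) = \<phi> (s i) + ?q i * \<phi> (s j)"
      using linear_map_on_add[OF \<phi> i q] linear_map_on_scale[OF \<phi> s[OF j(1)], of "?q i"] by simp
    then have "\<phi> (s i + ?q i *\<^sub>R s j) = 0" using j(2) by simp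
    then show ?thesis using subspace_add[OF E i q] by blast
  qed
  show "\<exists>c. v = (\<Sum>i\<in>I - {j}. c i *\<^sub>R (s i + ?q i *\<^sub>R s j))" if v: "v \<in> {v \<in> E. \<phi> v = 0}" for v
  proof -
    obtain c where c: "v = (\<Sum>i\<in>I. c i *\<^sub>R s i)" using frame_expand[OF F] v by auto
    have "\<phi> v = (\<Sum>i\<in>I. c i *\<^sub>R \<phi> (s i))"
      unfolding c using \<phi> E s by (rule linear_map_on_sum)
    then have "0 = (\<Sum>i\<in>I. c i * \<phi> (s i))" using v by simp
    also have "\<dots> = c j * \<phi> (s j) + (\<Sum>i\<in>I - {j}. c i * \<phi> (s i))"
      by (rule sum.remove[OF fin j(1)])
    finally have eq: "(\<Sum>i\<in>I - {j}. c i * \<phi> (s i)) = - (c j * \<phi> (s j))" by simp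
    have "(\<Sum>i\<in>I - {j}. c i * ?q i) = - ((\<Sum>i\<in>I - {j}. c i * \<phi> (s i)) / \<phi> (s j))"
      by (simp add: sum_negf sum_divide_distrib)
    also have "\<dots> = c j" unfolding eq using j(2) by simp
    finally have "c(j := \<Sum>i\<in>I - {j}. c i * ?q i) = c" by (intro fun_upd_idem) (rule sym)
    then have "v = (\<Sum>i\<in>I - {j}. c i *\<^sub>R (s i + ?q i *\<^sub>R s j))"
      unfolding sum_eq c by (simp only:)
    then show ?thesis by (rule exI[of _ c])
  qed
qed (use frame_finite[OF F] in simp)

definition local_frame ::
  "('a, 'f::euclidean_space) manifold \<Rightarrow> ('a, 'e::euclidean_space) manifold \<Rightarrow> 'a set \<Rightarrow> 'i set \<Rightarrow>
   ('i \<Rightarrow> 'a \<Rightarrow> ('a, 'e) tvec) \<Rightarrow> ('a \<Rightarrow> ('a, 'e) tvec set) \<Rightarrow> bool" where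
  "local_frame M N U I s E \<longleftrightarrow> openin (topo M) U \<and> (\<forall>i\<in>I. smooth_section M N U (s i)) \<and>
     (\<forall>p\<in>U. frame I (\<lambda>i. s i p) (E p))"

lemma smooth_subbundle_iff:
  "smooth_subbundle M N k E \<longleftrightarrow> (\<forall>x\<in>points M. \<exists>U s. x \<in> U \<and> local_frame M N U {..<k} s E)"
  unfolding smooth_subbundle_def local_frame_def frame_iff[OF finite_lessThan]
  by (intro ball_cong refl ex_cong1) (auto simp: lessThan_iff)

lemma local_frame_subset:
  "local_frame M N U I s E \<Longrightarrow> openin (topo M) U' \<Longrightarrow> U' \<subseteq> U \<Longrightarrow> local_frame M N U' I s E"
  using smooth_section_subset[of M N U _ U'] by (auto simp: local_frame_def)

lemma smooth_subbundle_cong: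
  assumes "smooth_subbundle M N k E" "\<And>p. p \<in> points M \<Longrightarrow> E' p = E p"
  shows "smooth_subbundle M N k E'"
  unfolding smooth_subbundle_iff
proof
  fix x assume "x \<in> points M"
  then obtain U s where s: "x \<in> U" "local_frame M N U {..<k} s E"
    using assms(1) unfolding smooth_subbundle_iff by blast
  then have "U \<subseteq> points M" by (simp add: local_frame_def openin_subset)
  with s(2) assms(2) have "local_frame M N U {..<k} s E'" by (simp add: local_frame_def subset_iff)
  with s(1) show "\<exists>U s. x \<in> U \<and> local_frame M N U {..<k} s E'" by blast
qed

lemma smooth_subbundleI:
  assumes "\<And>x. x \<in> points M \<Longrightarrow> \<exists>U (I :: 'i set) s. x \<in> U \<and> local_frame M N U I s E \<and> card I = k"
  shows "smooth_subbundle M N k E"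
  unfolding smooth_subbundle_iff
proof
  fix x assume "x \<in> points M"
  from assms[OF this] obtain U s and I :: "'i set"
    where s: "x \<in> U" "local_frame M N U I s E" "card I = k" by blast
  then have "frame I (\<lambda>i. s i x) (E x)" by (simp add: local_frame_def)
  then have "finite I" by (rule frame_finite)
  from ex_bij_betw_nat_finite[OF this] obtain \<pi> where \<pi>: "bij_betw \<pi> {..<k} I"
    unfolding s(3) atLeast0LessThan by blast
  have "local_frame M N U {..<k} (\<lambda>i. s (\<pi> i)) E"
    unfolding local_frame_def
  proof (intro conjI ballI)
    show "smooth_section M N U (s (\<pi> i))" if "i \<in> {..<k}" for i
      using s(2) bij_betwE[OF \<pi>] that by (simp add: local_frame_def)
    show "frame {..<k} (\<lambda>i. s (\<pi> i) p) (E p)" if "p \<in> U" for p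
      using s(2) that by (intro frame_reindex[OF \<pi>, of "\<lambda>i. s i p"]) (simp add: local_frame_def)
  qed (use s(2) in \<open>simp add: local_frame_def\<close>)
  with s(1) show "\<exists>U s. x \<in> U \<and> local_frame M N U {..<k} s E" by blast
qed

lemma smooth_subbundle_fibre:
  assumes "smooth_manifold N" "smooth_subbundle M N k E" "p \<in> points M"
  shows "\<exists>B. finite B \<and> E p = span B" "E p \<subseteq> tangent_space N p"
proof -
  obtain U s where s: "p \<in> U" "local_frame M N U {..<k} s E"
    using assms(2,3) unfolding smooth_subbundle_iff by blast
  then have F: "frame {..<k} (\<lambda>i. s i p) (E p)" and t: "\<And>i. i < k \<Longrightarrow> s i p \<in> tangent_space N p"
    using smooth_section_tangent[of M N U] by (simp_all add: local_frame_def)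
  show "\<exists>B. finite B \<and> E p = span B"
    using frame_span[OF F] by (intro exI[of _ "(\<lambda>i. s i p) ` {..<k}"]) simp
  show "E p \<subseteq> tangent_space N p"
    unfolding frame_span[OF F] by (intro span_minimal subspace_tangent_space assms(1)) (use t in auto)
qed

lemma smooth_subbundle_image:
  assumes "smooth_subbundle M P k E"
    and "\<And>x. x \<in> points M \<Longrightarrow> linear_map_on (tangent_space P x) (tangent_space N x) (L x)"
    and "\<And>x. x \<in> points M \<Longrightarrow> inj_on (L x) (tangent_space P x)"
    and "\<And>U V. openin (topo M) U \<Longrightarrow> smooth_section M P U V \<Longrightarrow> smooth_section M N U (\<lambda>x. L x (V x))"
    and "smooth_manifold P"
  shows "smooth_subbundle M N k (\<lambda>x. L x ` E x)"
  unfolding smooth_subbundle_iff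
proof
  fix x assume "x \<in> points M"
  then obtain U s where s: "x \<in> U" "local_frame M P U {..<k} s E"
    using assms(1) unfolding smooth_subbundle_iff by blast
  then have U: "openin (topo M) U" by (simp add: local_frame_def)
  have "frame {..<k} (\<lambda>i. L p (s i p)) (L p ` E p)" if "p \<in> U" for p
  proof (rule frame_image[where V = "tangent_space P p" and W = "tangent_space N p"])
    have p: "p \<in> points M" using openin_subset[OF U] that by auto
    show "frame {..<k} (\<lambda>i. s i p) (E p)" using s that by (simp add: local_frame_def)
    show "E p \<subseteq> tangent_space P p" using assms(5,1) p by (rule smooth_subbundle_fibre)
    show "subspace (tangent_space P p)" using assms(5) by (rule subspace_tangent_space)
  qed (use assms(2,3) openin_subset[OF U] that in auto)
  then have "local_frame M N U {..<k} (\<lambda>i p. L p (s i p)) (\<lambda>x. L x ` E x)"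
    using s(2) U assms(4)[OF U] by (simp add: local_frame_def)
  with s(1) show "\<exists>U s. x \<in> U \<and> local_frame M N U {..<k} s (\<lambda>x. L x ` E x)" by blast
qed

lemma distribution_subbundle:
  assumes MN: "submanifold M N" and "distribution_on M N k D"
  shows "smooth_subbundle M N k D"
proof -
  note i = submanifold_inclusion[OF MN]
  obtain D' where D': "smooth_subbundle M M k D'"
    and D: "\<And>x. x \<in> points M \<Longrightarrow> D x = differential M N id x ` D' x"
    using assms(2) unfolding distribution_on_def by blast
  have "smooth_subbundle M N k (\<lambda>x. differential M N id x ` D' x)"
    using D'
  proof (rule smooth_subbundle_image)
    show "linear_map_on (tangent_space M x) (tangent_space N x) (differential M N id x)"
      if "x \<in> points M" for x using i that by (rule linear_differential)
    show "inj_on (differential M N id x) (tangent_space M x)" if "x \<in> points M" for x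
      using MN that by (simp add: submanifold_def)
    show "smooth_section M N U (\<lambda>x. differential M N id x (V x))"
      if "openin (topo M) U" "smooth_section M M U V" for U V
      using i that by (rule smooth_section_differential)
  qed (rule smooth_inclusionD(1)[OF i])
  then show ?thesis using D by (rule smooth_subbundle_cong)
qed

text \<open>
  A member of the frame on which the functional is nonzero at \<open>x\<close> serves as pivot of the elimination step,
  on the neighbourhood of \<open>x\<close> where it stays nonzero.
\<close>

lemma local_frame_kernel:
  assumes MN: "smooth_inclusion M N" and F: "local_frame M N U I s E" and x: "x \<in> U"
    and \<phi>: "\<And>p. p \<in> U \<Longrightarrow> linear_map_on (E p) UNIV (\<phi> p)"
    and smooth: "\<And>i. i \<in> I \<Longrightarrow> smooth_function M U (\<lambda>p. \<phi> p (s i p))"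
    and nz: "v \<in> E x" "\<phi> x v \<noteq> 0"
  shows "\<exists>U' j t. x \<in> U' \<and> U' \<subseteq> U \<and> j \<in> I \<and> local_frame M N U' (I - {j}) t (\<lambda>p. {v \<in> E p. \<phi> p v = 0})"
proof -
  note M = smooth_inclusionD(1)[OF MN]
  have U: "openin (topo M) U" and s: "\<And>i. i \<in> I \<Longrightarrow> smooth_section M N U (s i)"
    and Fp: "\<And>p. p \<in> U \<Longrightarrow> frame I (\<lambda>i. s i p) (E p)"
    using F by (auto simp: local_frame_def)
  have "\<exists>j\<in>I. \<phi> x (s j x) \<noteq> 0"
  proof (rule ccontr)
    assume no: "\<not> ?thesis"
    obtain c where c: "v = (\<Sum>i\<in>I. c i *\<^sub>R s i x)" using frame_expand[OF Fp[OF x] nz(1)] by blast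
    have "\<phi> x v = (\<Sum>i\<in>I. c i *\<^sub>R \<phi> x (s i x))"
      unfolding c using \<phi>[OF x] frame_subspace[OF Fp[OF x]] frame_in[OF Fp[OF x]]
      by (rule linear_map_on_sum)
    with no nz(2) show False by simp
  qed
  then obtain j where j: "j \<in> I" "\<phi> x (s j x) \<noteq> 0" by blast
  define U' where "U' = {p \<in> U. \<phi> p (s j p) \<noteq> 0}"
  have U': "openin (topo M) U'" "U' \<subseteq> U" "x \<in> U'"
    using open_nonzero[OF M U smooth[OF j(1)]] x j(2) by (auto simp: U'_def)
  define t where "t i p = s i p + (- (\<phi> p (s i p) / \<phi> p (s j p))) *\<^sub>R s j p" for i p
  have "local_frame M N U' (I - {j}) t (\<lambda>p. {v \<in> E p. \<phi> p v = 0})"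
    unfolding local_frame_def
  proof (intro conjI ballI)
    fix i assume "i \<in> I - {j}"
    then have "i \<in> I" by simp
    note sub = smooth_function_subset[OF _ U'(2)] smooth_section_subset[OF _ U'(2)]
    show "smooth_section M N U' (t i)"
      unfolding t_def[abs_def]
      using sub(2)[OF s[OF \<open>i \<in> I\<close>]] sub(2)[OF s[OF j(1)]]
        smooth_function_divide[OF M U'(1) sub(1)[OF smooth[OF \<open>i \<in> I\<close>]] sub(1)[OF smooth[OF j(1)]]]
      by (intro smooth_section_add_scale[OF MN U'(1)]) (auto simp: U'_def)
  next
    fix p assume "p \<in> U'"
    then have "p \<in> U" "\<phi> p (s j p) \<noteq> 0" by (auto simp: U'_def)
    then show "frame (I - {j}) (\<lambda>i. t i p) {v \<in> E p. \<phi> p v = 0}"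
      unfolding t_def using Fp \<phi> j(1) by (intro frame_kernel) auto
  qed (rule U'(1))
  with U' j(1) show ?thesis by blast
qed

lemma tangent_form_space:
  assumes "smooth_manifold N" "semi_riemannian_metric N g" "p \<in> points N"
  shows "form_space (tangent_space N p) (g p)"
  using assms subspace_tangent_space[OF assms(1)] by (simp add: form_space_def semi_riemannian_metric_def)

text \<open>
  Orthogonal complements are smooth bundles: start from a coordinate frame of \<open>TN\<close> and pass to the
  kernels of the functionals \<open>g (w a)\<close> one after the other. Each of them is nonzero on the common
  kernel of the previous ones, as otherwise it would be a combination of them, and by
  nondegeneracy \<open>w a\<close> would be a combination of the other vectors. The rank is recorded since it must be
  the same at all points. Linear independence at the single point \<open>x\<close> suffices because the pivots stay
  nonzero nearby.
\<close>

lemma local_frame_orth: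
  fixes N :: "('a, 'e::euclidean_space) manifold"
  assumes MN: "smooth_inclusion M N" and g: "semi_riemannian_metric N g"
    and "finite A" and U: "openin (topo M) U" and x: "x \<in> U"
    and w: "\<And>a. a \<in> A \<Longrightarrow> smooth_section M N U (w a)"
    and ind: "\<forall>c. (\<Sum>a\<in>A. c a *\<^sub>R w a x) = 0 \<longrightarrow> (\<forall>a\<in>A. c a = 0)"
  shows "\<exists>U' I s. x \<in> U' \<and> U' \<subseteq> U \<and> card (I :: 'e set) + card A = DIM('e) \<and>
    local_frame M N U' I s (\<lambda>p. orth (g p) (tangent_space N p) ((\<lambda>a. w a p) ` A))"
  using assms(3) w ind
proof (induction A rule: finite_induct)
  case empty
  note M = smooth_inclusionD[OF MN]
  have xM: "x \<in> points M" using openin_subset[OF U] x by auto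
  then have "x \<in> points N" using M(3) by auto
  with M(2) obtain d where "d \<in> charts_at N x" by (rule charts_at_nonempty)
  then have d: "d \<in> atlas N" "x \<in> cdom d" by (auto simp: charts_at_def)
  let ?U = "U \<inter> cdom d"
  have U': "openin (topo M) ?U" using MN U openin_cdom[OF M(2) d(1)] by (rule openin_Int_ambient)
  have "local_frame M N ?U Basis (coord_vector N d) (tangent_space N)"
    unfolding local_frame_def
    using U' smooth_section_coord_vector[OF MN U' d(1)] coord_vector_frame[OF M(2), of d] d(1)
    by (auto simp: charts_at_def)
  then show ?case using x d(2)
    by (intro exI[of _ ?U] exI[of _ Basis] exI[of _ "coord_vector N d"]) (auto simp: orth_def)
next
  case (insert a A)
  note M = smooth_inclusionD[OF MN]
  let ?E = "\<lambda>p. orth (g p) (tangent_space N p) ((\<lambda>a. w a p) ` A)"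
  have ind: "\<forall>c. (\<Sum>a\<in>A. c a *\<^sub>R w a x) = 0 \<longrightarrow> (\<forall>a\<in>A. c a = 0)"
  proof (intro allI impI ballI)
    fix c a' assume that: "(\<Sum>a\<in>A. c a *\<^sub>R w a x) = 0" "a' \<in> A"
    have "(\<Sum>b\<in>insert a A. (c(a := 0)) b *\<^sub>R w b x) = (\<Sum>b\<in>A. c b *\<^sub>R w b x)"
      using insert.hyps by (simp, intro sum.cong) auto
    then have "(c(a := 0)) a' = 0"
      using insert.prems(2)[rule_format, of "c(a := 0)" a'] that by simp
    then show "c a' = 0" using that insert.hyps by (auto split: if_splits)
  qed
  obtain U' s and I :: "'e set" where s: "x \<in> U'" "U' \<subseteq> U" "card I + card A = DIM('e)"
      "local_frame M N U' I s ?E"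
    using insert.IH[OF insert.prems(1)[OF insertI2] ind] by blast
  have U': "openin (topo M) U'" using s(4) by (simp add: local_frame_def)
  have pN: "p \<in> points N" if "p \<in> U'" for p using openin_subset[OF U'] M(3) that by auto
  note form = tangent_form_space[OF M(2) g pN]
  have wa: "w b p \<in> tangent_space N p" if "b \<in> insert a A" "p \<in> U'" for b p
    using smooth_section_tangent[OF insert.prems(1)[OF that(1)]] s(2) that(2) by blast
  have "\<exists>v\<in>?E x. g x (w a x) v \<noteq> 0"
  proof (rule ccontr)
    assume no: "\<not> ?thesis"
    interpret form_space "tangent_space N x" "g x" using form[OF s(1)] .
    note wx = wa[OF _ s(1)]
    have "\<exists>c. \<forall>v\<in>tangent_space N x. g x (w a x) v = (\<Sum>b\<in>A. c b * g x (w b x) v)"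
    proof (rule functional_combination[OF subspace insert.hyps(1)])
      fix v assume v: "v \<in> tangent_space N x" "\<And>b. b \<in> A \<Longrightarrow> g x (w b x) v = 0"
      have "g x v (w b x) = 0" if "b \<in> A" for b
        using v(2)[OF that] sym[OF v(1) wx] that by simp
      then have "v \<in> ?E x" using v(1) by (simp add: orth_def)
      with no show "g x (w a x) v = 0" by blast
    qed (use linear wx in auto)
    then obtain c where c: "\<And>v. v \<in> tangent_space N x \<Longrightarrow> g x (w a x) v = (\<Sum>b\<in>A. c b * g x (w b x) v)"
      by blast
    let ?u = "w a x - (\<Sum>b\<in>A. c b *\<^sub>R w b x)"
    have S: "(\<Sum>b\<in>A. c b *\<^sub>R w b x) \<in> tangent_space N x"
      using subspace wx by (intro subspace_sum subspace_scale) auto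
    have "g x ?u v = 0" if v: "v \<in> tangent_space N x" for v
      using c[OF v] sum_left[OF v, of A "\<lambda>b. w b x" c] wx S v by (simp add: diff_left)
    moreover have "nondegenerate_on (tangent_space N x) (g x)"
      using g pN[OF s(1)] by (simp add: semi_riemannian_metric_def)
    ultimately have "?u = 0" using closed(3)[OF wx[OF insertI1] S] unfolding nondegenerate_on_def by blast
    have "(\<Sum>b\<in>insert a A. ((\<lambda>b. - c b)(a := 1)) b *\<^sub>R w b x) = w a x + (\<Sum>b\<in>A. (- c b) *\<^sub>R w b x)"
      using insert.hyps by (simp, intro sum.cong) auto
    also have "\<dots> = 0" using \<open>?u = 0\<close> by (simp add: sum_negf)
    finally have "((\<lambda>b. - c b)(a := 1)) a = (0::real)" by (rule insert.prems(2)[rule_format]) simp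
    then show False by simp
  qed
  then obtain v where v: "v \<in> ?E x" "g x (w a x) v \<noteq> 0" by blast
  have "\<exists>U'' j t. x \<in> U'' \<and> U'' \<subseteq> U' \<and> j \<in> I \<and>
      local_frame M N U'' (I - {j}) t (\<lambda>p. {v \<in> ?E p. g p (w a p) v = 0})"
  proof (rule local_frame_kernel[OF MN s(4,1), where \<phi> = "\<lambda>p. g p (w a p)" and v = v])
    show "linear_map_on (?E p) UNIV (g p (w a p))" if "p \<in> U'" for p
      using form_space.linear[OF form[OF that] wa[OF insertI1 that]] by (auto simp: linear_map_on_def orth_def)
    show "smooth_function M U' (\<lambda>p. g p (w a p) (s i p))" if "i \<in> I" for i
      using s(4) that smooth_section_subset[OF insert.prems(1)[OF insertI1] s(2)]
      by (intro smooth_function_metric[OF MN g U']) (auto simp: local_frame_def)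
  qed (rule v)+
  then obtain U'' j t where t: "x \<in> U''" "U'' \<subseteq> U'" "j \<in> I"
    "local_frame M N U'' (I - {j}) t (\<lambda>p. {v \<in> ?E p. g p (w a p) v = 0})" by blast
  have eq: "{v \<in> ?E p. g p (w a p) v = 0} = orth (g p) (tangent_space N p) ((\<lambda>a. w a p) ` insert a A)"
    if "p \<in> U''" for p
  proof -
    have p: "p \<in> U'" using that t(2) by auto
    show ?thesis
      using form_space.sym[OF form[OF p] wa[OF insertI1 p]] by (auto simp: orth_def)
  qed
  have "local_frame M N U'' (I - {j}) t (\<lambda>p. orth (g p) (tangent_space N p) ((\<lambda>a. w a p) ` insert a A))"
    using t(4) unfolding local_frame_def by (simp add: eq)
  moreover have "frame I (\<lambda>i. s i x) (?E x)" using s(4,1) by (simp add: local_frame_def)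
  then have "finite I" by (rule frame_finite)
  from card_Suc_Diff1[OF this t(3)] have "card (I - {j}) + card (insert a A) = DIM('e)"
    using s(3) insert.hyps by simp
  ultimately show ?case using t(1,2) s(2) by blast
qed

lemma norden_tangent_space:
  assumes "almost_complex_norden_manifold N J g" "p \<in> points N"
  shows "norden_space (tangent_space N p) (g p) (J p)"
proof -
  have N: "smooth_manifold N" "almost_complex_structure N J" "semi_riemannian_metric N g"
    using assms(1) by (simp_all add: almost_complex_norden_manifold_def)
  interpret form_space "tangent_space N p" "g p" using N(1,3) assms(2) by (rule tangent_form_space)
  show ?thesis
    by unfold_locales
      (use N assms in \<open>simp_all add: almost_complex_structure_def semi_riemannian_metric_def
        almost_complex_norden_manifold_def\<close>)
qed

text \<open>
  The \<open>g\<close>-orthogonal complement of \<open>D + P + J P\<close> will be the screen transversal bundle. It is smooth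
  because local frames of \<open>D\<close> and \<open>P\<close>, together with the image under \<open>J\<close> of the latter, form a linearly
  independent family of smooth sections.
\<close>

lemma CR_orth_complement_subbundle:
  fixes N :: "('a, 'e::euclidean_space) manifold"
  assumes N: "almost_complex_norden_manifold N J g" and MN: "smooth_inclusion M N"
    and D: "smooth_subbundle M N k D" and P: "smooth_subbundle M N r P"
    and indep: "\<And>x d p q. x \<in> points M \<Longrightarrow> d \<in> D x \<Longrightarrow> p \<in> P x \<Longrightarrow> q \<in> P x \<Longrightarrow> d + p + J x q = 0 \<Longrightarrow>
      d = 0 \<and> p = 0 \<and> q = 0"
  shows "smooth_subbundle M N (DIM('e) - (k + r + r))
    (\<lambda>x. orth (g x) (tangent_space N x) (D x \<union> P x \<union> J x ` P x))"
proof (rule smooth_subbundleI)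
  fix x assume x: "x \<in> points M"
  note M = smooth_inclusionD[OF MN]
  have J: "almost_complex_structure N J" and g: "semi_riemannian_metric N g"
    using N by (simp_all add: almost_complex_norden_manifold_def)
  obtain U1 u where u: "x \<in> U1" "local_frame M N U1 {..<k} u D"
    using D x unfolding smooth_subbundle_iff by blast
  obtain U2 s where s: "x \<in> U2" "local_frame M N U2 {..<r} s P"
    using P x unfolding smooth_subbundle_iff by blast
  define U where "U = U1 \<inter> U2"
  have U: "openin (topo M) U" using u s by (auto simp: U_def local_frame_def)
  have u': "local_frame M N U {..<k} u D" and s': "local_frame M N U {..<r} s P"
    using local_frame_subset[OF u(2) U] local_frame_subset[OF s(2) U] by (auto simp: U_def)
  have xU: "x \<in> U" using u s by (simp add: U_def)
  have UM: "p \<in> points M" "p \<in> points N" if "p \<in> U" for p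
    using openin_subset[OF U] M(3) that by auto
  have Du: "frame {..<k} (\<lambda>i. u i p) (D p)" and Ps: "frame {..<r} (\<lambda>i. s i p) (P p)" if "p \<in> U" for p
    using u' s' that by (auto simp: local_frame_def)
  have DP: "D p \<subseteq> tangent_space N p" "P p \<subseteq> tangent_space N p" if "p \<in> U" for p
    using smooth_subbundle_fibre(2)[OF M(2) D] smooth_subbundle_fibre(2)[OF M(2) P] UM(1)[OF that] by auto
  define A where "A = {..<k} <+> ({..<r} <+> {..<r})"
  define w where "w = case_sum u (case_sum s (\<lambda>i p. J p (s i p)))"
  have A: "finite A" "card A = k + r + r" by (simp_all add: A_def card_Plus)
  have w: "smooth_section M N U (w a)" if "a \<in> A" for a
    using that u' s' smooth_section_J[OF MN J U]
    by (auto simp: A_def w_def local_frame_def)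
  have JP: "frame {..<r} (\<lambda>i. J p (s i p)) (J p ` P p)" if "p \<in> U" for p
  proof -
    interpret norden_space "tangent_space N p" "g p" "J p"
      using N UM(2)[OF that] by (rule norden_tangent_space)
    show ?thesis using Ps[OF that] DP(2)[OF that] subspace J J_inj by (rule frame_image)
  qed
  have ind: "\<forall>c. (\<Sum>a\<in>A. c a *\<^sub>R w a x) = 0 \<longrightarrow> (\<forall>a\<in>A. c a = 0)"
  proof (intro allI impI ballI)
    fix c a assume c: "(\<Sum>a\<in>A. c a *\<^sub>R w a x) = 0" and a: "a \<in> A"
    interpret norden_space "tangent_space N x" "g x" "J x"
      using N UM(2)[OF xU] by (rule norden_tangent_space)
    let ?d = "\<Sum>i<k. c (Inl i) *\<^sub>R u i x" and ?p = "\<Sum>i<r. c (Inr (Inl i)) *\<^sub>R s i x"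
      and ?q = "\<Sum>i<r. c (Inr (Inr i)) *\<^sub>R s i x"
    have Jq: "J x ?q = (\<Sum>i<r. c (Inr (Inr i)) *\<^sub>R J x (s i x))"
      by (rule linear_map_on_sum[OF J subspace]) (use frame_in[OF Ps[OF xU]] DP(2)[OF xU] in auto)
    have "?d + ?p + J x ?q = 0"
      unfolding Jq using c by (simp add: A_def w_def sum.Plus add.assoc)
    moreover have "?d \<in> D x" "?p \<in> P x" "?q \<in> P x"
      using frame_subspace[OF Du[OF xU]] frame_in[OF Du[OF xU]] frame_subspace[OF Ps[OF xU]] frame_in[OF Ps[OF xU]]
      by (auto intro!: subspace_sum subspace_scale)
    ultimately have "?d = 0" "?p = 0" "?q = 0" using indep[OF x] by blast+
    then show "c a = 0"
      using a frame_zero[OF Du[OF xU], of "\<lambda>i. c (Inl i)"]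
        frame_zero[OF Ps[OF xU], of "\<lambda>i. c (Inr (Inl i))"] frame_zero[OF Ps[OF xU], of "\<lambda>i. c (Inr (Inr i))"]
      by (auto simp: A_def)
  qed
  obtain U' t and I :: "'e set" where t: "x \<in> U'" "U' \<subseteq> U" "card I + card A = DIM('e)"
    "local_frame M N U' I t (\<lambda>p. orth (g p) (tangent_space N p) ((\<lambda>a. w a p) ` A))"
    using local_frame_orth[OF MN g A(1) U xU w ind] by blast
  have "orth (g p) (tangent_space N p) ((\<lambda>a. w a p) ` A) =
      orth (g p) (tangent_space N p) (D p \<union> P p \<union> J p ` P p)" if "p \<in> U'" for p
  proof -
    have p: "p \<in> U" using that t(2) by auto
    interpret form_space "tangent_space N p" "g p" using M(2) g UM(2)[OF p] by (rule tangent_form_space)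
    have in_T: "(\<lambda>a. w a p) ` A \<subseteq> tangent_space N p"
      using smooth_section_tangent[OF w p] by auto
    have un: "orth (g p) V (X \<union> Y) = orth (g p) V X \<inter> orth (g p) V Y" for V X Y
      by (auto simp: orth_def)
    have wA: "(\<lambda>a. w a p) ` A =
        (\<lambda>i. u i p) ` {..<k} \<union> (\<lambda>i. s i p) ` {..<r} \<union> (\<lambda>i. J p (s i p)) ` {..<r}"
      unfolding A_def w_def by (force simp: image_iff)
    show ?thesis
      using in_T orth_span[of "(\<lambda>i. u i p) ` {..<k}"] orth_span[of "(\<lambda>i. s i p) ` {..<r}"]
        orth_span[of "(\<lambda>i. J p (s i p)) ` {..<r}"]
      unfolding wA un frame_span[OF Du[OF p], symmetric] frame_span[OF Ps[OF p], symmetric]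
        frame_span[OF JP[OF p], symmetric] by simp
  qed
  then have "local_frame M N U' I t (\<lambda>p. orth (g p) (tangent_space N p) (D p \<union> P p \<union> J p ` P p))"
    using t(4) by (simp add: local_frame_def)
  moreover have "card I = DIM('e) - (k + r + r)" using t(3) A(2) by simp
  ultimately show "\<exists>U (I :: 'e set) t. x \<in> U \<and> local_frame M N U I t
      (\<lambda>p. orth (g p) (tangent_space N p) (D p \<union> P p \<union> J p ` P p)) \<and> card I = DIM('e) - (k + r + r)"
    using t(1) by (intro exI[of _ U'] exI[of _ I] exI[of _ t]) simp
qed

section \<open>CR-submanifolds and radical transversal lightlike submanifolds\<close>

lemma sub_tangent_space_subset:
  "smooth_inclusion M N \<Longrightarrow> x \<in> points M \<Longrightarrow> sub_tangent_space M N x \<subseteq> tangent_space N x"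
  using linear_differential[of M N x] by (auto simp: sub_tangent_space_def linear_map_on_def)

text \<open>
  The screen distribution is \<open>D\<close>, the radical is \<open>P\<close>, and the transversal bundles are the orthogonal
  complement \<open>K\<close> of \<open>D + P + J P\<close> and \<open>J P\<close>.
\<close>

lemma CR_imp_radical_transversal:
  fixes N :: "('a, 'e::euclidean_space) manifold"
  assumes N: "almost_complex_norden_manifold N J g" and MN: "submanifold M N" and r: "r \<ge> 1"
    and CR: "CR_submanifold M N J g D P" and dP: "distribution_on M N r P"
  shows "radical_transversal_lightlike_submanifold r M N J (associated_metric J g)"
proof -
  note i = submanifold_inclusion[OF MN]
  note M = smooth_inclusionD[OF i]
  obtain k where dD: "distribution_on M N k D" using CR by (auto simp: CR_submanifold_def)
  note sD = distribution_subbundle[OF MN dD] and sP = distribution_subbundle[OF MN dP]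
  define T where "T = sub_tangent_space M N"
  define V where "V = tangent_space N"
  define h where "h x u = g x (J x u)" for x u
  have hx: "h x = (\<lambda>u. g x (J x u))" for x by (rule ext) (simp only: h_def)
  define K where "K x = orth (g x) (V x) (D x \<union> P x \<union> J x ` P x)" for x
  have ns: "norden_space (V x) (g x) (J x)" if "x \<in> points M" for x
    unfolding V_def using N M(3) that by (blast intro: norden_tangent_space)
  have facts: "T x \<inter> orth (h x) (V x) (T x) = P x" "nondegenerate_on (D x) (h x)"
      "direct_sum (orth (h x) (V x) (T x)) (P x) (K x)" "nondegenerate_on (K x) (h x)"
      "direct_sum (orth (h x) (V x) {u + v |u v. u \<in> D x \<and> v \<in> K x}) (P x) (J x ` P x)"
      "\<forall>u\<in>J x ` P x. \<forall>v\<in>J x ` P x. h x u v = 0"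
    and indep: "\<And>d p q. d \<in> D x \<Longrightarrow> p \<in> P x \<Longrightarrow> q \<in> P x \<Longrightarrow> d + p + J x q = 0 \<Longrightarrow>
      d = 0 \<and> p = 0 \<and> q = 0"
    if x: "x \<in> points M" for x
  proof -
    obtain B C where B: "finite B" "P x = span B" and C: "finite C" "D x = span C"
      using smooth_subbundle_fibre(1)[OF M(2) sP x] smooth_subbundle_fibre(1)[OF M(2) sD x] by blast
    note sub = smooth_subbundle_fibre(2)[OF M(2) sP x] smooth_subbundle_fibre(2)[OF M(2) sD x]
    have cr: "direct_sum (T x) (D x) (P x)" "nondegenerate_on (T x) (g x)"
      "\<forall>u\<in>D x. \<forall>v\<in>P x. g x u v = 0" "J x ` D x = D x"
      "J x ` P x \<subseteq> orth (g x) (V x) (T x)"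
      using CR x by (simp_all add: CR_submanifold_def normal_space_def T_def V_def)
    note R = norden_space.CR_imp_radical[OF ns[OF x] sub(1)[folded V_def] B sub(2)[folded V_def] C cr,
        folded K_def hx]
    show "T x \<inter> orth (h x) (V x) (T x) = P x" "nondegenerate_on (D x) (h x)"
      "direct_sum (orth (h x) (V x) (T x)) (P x) (K x)" "nondegenerate_on (K x) (h x)"
      "direct_sum (orth (h x) (V x) {u + v |u v. u \<in> D x \<and> v \<in> K x}) (P x) (J x ` P x)"
      by (rule R)+
    show "\<forall>u\<in>J x ` P x. \<forall>v\<in>J x ` P x. h x u v = 0" unfolding h_def by (rule R(6))
    show "d = 0 \<and> p = 0 \<and> q = 0" if "d \<in> D x" "p \<in> P x" "q \<in> P x" "d + p + J x q = 0" for d p q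
      using that by (rule R(7))
  qed
  have sK: "smooth_subbundle M N (DIM('e) - (k + r + r)) K"
    unfolding K_def[abs_def] V_def
    using N i sD sP indep by (rule CR_orth_complement_subbundle)
  have Jc: "almost_complex_structure N J" using N by (simp add: almost_complex_norden_manifold_def)
  have sJP: "smooth_subbundle M N r (\<lambda>x. J x ` P x)"
    using sP
  proof (rule smooth_subbundle_image)
    show "linear_map_on (tangent_space N x) (tangent_space N x) (J x)" if "x \<in> points M" for x
      using norden_space.J[OF ns[OF that]] by (simp add: V_def)
    show "inj_on (J x) (tangent_space N x)" if "x \<in> points M" for x
      using norden_space.J_inj[OF ns[OF that]] by (simp add: V_def)
    show "smooth_section M N U (\<lambda>x. J x (W x))" if "openin (topo M) U" "smooth_section M N U W" for U W
      using i Jc that by (rule smooth_section_J)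
  qed (rule M(2))
  let ?h = "associated_metric J g"
  have h: "?h x = h x" for x by (intro ext) (simp only: associated_metric_def h_def)
  have nh: "normal_space M N ?h x = orth (h x) (V x) (T x)" for x
    by (simp add: normal_space_def h V_def T_def)
  have Rad: "Rad M N ?h x = P x" if "x \<in> points M" for x
    using facts(1)[OF that] by (simp add: Rad_def nh T_def)
  have "distribution_on M N r (Rad M N ?h)"
    using dP Rad by (simp add: distribution_on_def)
  then have "lightlike_submanifold r M N ?h" using MN r by (simp add: lightlike_submanifold_def)
  moreover have "screen_distribution M N ?h D"
    unfolding screen_distribution_def
  proof (intro conjI ballI)
    fix x assume x: "x \<in> points M"
    have "direct_sum (sub_tangent_space M N x) (D x) (P x)" using CR x by (simp add: CR_submanifold_def)
    then show "direct_sum (sub_tangent_space M N x) (Rad M N ?h x) (D x)"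
      unfolding Rad[OF x] by (rule direct_sum_commute)
    show "nondegenerate_on (D x) (?h x)" unfolding h using x by (rule facts)
  qed (rule exI[of _ k], rule dD)
  moreover have "screen_transversal_bundle M N ?h K"
    unfolding screen_transversal_bundle_def nh h using sK facts(3,4) Rad[unfolded h] by auto
  moreover have "lightlike_transversal_bundle M N ?h D K (\<lambda>x. J x ` P x)"
    unfolding lightlike_transversal_bundle_def h
    using sJP facts(5,6)[unfolded V_def] Rad[unfolded h] by auto
  moreover have "J x ` Rad M N ?h x = J x ` P x \<and> J x ` D x = D x" if "x \<in> points M" for x
    using CR that by (simp add: CR_submanifold_def Rad)
  ultimately show ?thesis
    unfolding radical_transversal_lightlike_submanifold_def
    by (intro conjI exI[of _ D] exI[of _ K] exI[of _ "\<lambda>x. J x ` P x"]) simp_all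
qed

text \<open>
  The screen distribution and the radical are the invariant and the totally real distribution of the
  CR-structure.
\<close>

lemma radical_transversal_imp_CR:
  fixes N :: "('a, 'e::euclidean_space) manifold"
  assumes N: "almost_complex_norden_manifold N J g" and MN: "submanifold M N"
    and RT: "radical_transversal_lightlike_submanifold r M N J (associated_metric J g)"
  shows "\<exists>D P. CR_submanifold M N J g D P \<and> distribution_on M N r P"
proof -
  note i = submanifold_inclusion[OF MN]
  note M = smooth_inclusionD[OF i]
  let ?h = "associated_metric J g"
  define R where "R = Rad M N ?h"
  have dR: "distribution_on M N r R"
    using RT by (simp add: radical_transversal_lightlike_submanifold_def lightlike_submanifold_def R_def)
  obtain S Z L where S: "screen_distribution M N ?h S" and Z: "screen_transversal_bundle M N ?h Z"
    and L: "lightlike_transversal_bundle M N ?h S Z L"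
    and JSR: "\<forall>x\<in>points M. J x ` Rad M N ?h x = L x \<and> J x ` S x = S x"
    using RT unfolding radical_transversal_lightlike_submanifold_def by blast
  have JR: "J x ` R x = L x" and JS: "J x ` S x = S x" if "x \<in> points M" for x
    using JSR that by (simp_all add: R_def)
  obtain k l where dS: "distribution_on M N k S" and sZ: "smooth_subbundle M N l Z"
    using S Z unfolding screen_distribution_def screen_transversal_bundle_def by blast
  note sS = distribution_subbundle[OF MN dS]
  define T where "T = sub_tangent_space M N"
  define V where "V = tangent_space N"
  define h where "h x u = g x (J x u)" for x u
  have hx: "h x = (\<lambda>u. g x (J x u))" for x by (rule ext) (simp only: h_def)
  have h: "?h x = h x" for x by (intro ext) (simp only: associated_metric_def h_def)
  have nh: "normal_space M N ?h x = orth (h x) (V x) (T x)" for x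
    by (simp add: normal_space_def h V_def T_def)
  have "nondegenerate_on (T x) (g x) \<and> direct_sum (T x) (S x) (R x) \<and>
      (\<forall>u\<in>S x. \<forall>v\<in>R x. g x u v = 0) \<and> J x ` R x \<subseteq> orth (g x) (V x) (T x)"
    if x: "x \<in> points M" for x
  proof -
    interpret norden_space "V x" "g x" "J x"
      unfolding V_def using N M(3) x by (blast intro: norden_tangent_space)
    obtain B C where B: "finite B" "S x = span B" and C: "finite C" "Z x = span C"
      using smooth_subbundle_fibre(1)[OF M(2) sS x] smooth_subbundle_fibre(1)[OF M(2) sZ x] by blast
    note sub = smooth_subbundle_fibre(2)[OF M(2) sS x, folded V_def]
      smooth_subbundle_fibre(2)[OF M(2) sZ x, folded V_def]
      sub_tangent_space_subset[OF i x, folded V_def T_def]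
    have R: "R x = T x \<inter> orth (h x) (V x) (T x)" by (simp add: R_def Rad_def nh T_def)
    have s: "direct_sum (T x) (R x) (S x)" "nondegenerate_on (S x) (h x)"
      using S x by (simp_all add: screen_distribution_def T_def R_def h)
    have z: "direct_sum (orth (h x) (V x) (T x)) (R x) (Z x)" "nondegenerate_on (Z x) (h x)"
      using Z x by (simp_all add: screen_transversal_bundle_def R_def h nh)
    have l: "direct_sum (orth (h x) (V x) {u + v |u v. u \<in> S x \<and> v \<in> Z x}) (R x) (L x)"
      "\<forall>u\<in>L x. \<forall>v\<in>L x. g x (J x u) v = 0"
      using L x by (simp_all add: lightlike_transversal_bundle_def R_def h h_def V_def)
    show ?thesis
      by (intro conjI radical_imp_CR[OF sub(3,1) B sub(2) C, folded hx, OF R s z l JR[OF x] JS[OF x]])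
  qed
  moreover have "\<exists>k. distribution_on M N k S" "\<exists>k. distribution_on M N k R" using dS dR by blast+
  ultimately have "CR_submanifold M N J g S R"
    using MN JS by (simp add: CR_submanifold_def normal_space_def T_def V_def)
  with dR show ?thesis by blast
qed

theorem theorem3p2:
  fixes N :: "('a, 'e::euclidean_space) manifold"
    and M :: "('a, 'f::euclidean_space) manifold"
    and J :: "('a, 'e) endo_field"
    and g :: "('a, 'e) form_field"
    and n m r :: nat
  assumes "almost_complex_norden_manifold N J g"
    and "DIM('e) = 2 * n"
    and "submanifold M N"
    and "DIM('f) = m"
    and "r \<ge> 1"
  shows "(\<exists>D Dperp. CR_submanifold M N J g D Dperp \<and> distribution_on M N r Dperp) \<longleftrightarrow>
         radical_transversal_lightlike_submanifold r M N J (associated_metric J g)"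
  using CR_imp_radical_transversal[OF assms(1,3,5)] radical_transversal_imp_CR[OF assms(1,3)] by blast

end
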